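(* Let $\mathcal{A}_\mathsf{t} = (Q_\mathsf{t}, \delta_\mathsf{t}, i_\mathsf{t}, o_\mathsf{t})$ be an automaton in $\mathbf{C}$ such that $Q_\mathsf{t}$ has finitely many isomorphism classes of subobjects and finitely many isomorphism classes of quotients. Then for every run $\{\mathcal{W}_n = (\alpha_n, \beta_n)\}_{n\in\mathbb{N}}$ there exists $n\in\mathbb{N}$ such that $\mathcal{W}_n$ is closed and consistent and its hypothesis is correct, i.e. $\mathcal{L}_{\mathcal{H}_{\mathcal{W}_n}} = \mathcal{L}_{\mathcal{A}_\mathsf{t}}$. If moreover $\mathcal{A}_\mathsf{t}$ is minimal and for every $k\in\mathbb{N}$ there exists a recursive coalgebra $\rho_k\colon S_k\to F_I S_k$ such that $\alpha_k = [i_\mathsf{t},\delta_\mathsf{t}]^{\rho_k}$, then the final hypothesis $\mathcal{H}_{\mathcal{W}_n}$ (that is, for $n$ such that $\mathcal{W}_n$ is closed and consistent with correct hypothesis, from which point on the run is constant) is minimal.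
   Context: Setting. $\mathbf{C}$ is a category with finite products and coproducts (initial object $0$, terminal object $1$) and a fixed factorisation system $(\mathcal{E},\mathcal{M})$: $\mathcal{E}$ and $\mathcal{M}$ are classes of morphisms closed under composition with isomorphisms, every morphism $f$ factors as $f=f^\triangleleft\circ f^\triangleright$ with $f^\triangleright\in\mathcal{E}$, $f^\triangleleft\in\mathcal{M}$, and the unique diagonal fill-in property holds. $\mathcal{E}$ consists of epis and $\mathcal{M}$ of monos. $F\colon\mathbf{C}\to\mathbf{C}$ is an endofunctor that preserves $\mathcal{E}$ and is a varietor, i.e. there is a free $F$-algebra monad $(T,\eta,\mu)$; $\gamma_X\colon FTX\to TX$ is the structure of the free $F$-algebra on $X$, and for an $F$-algebra $(Y,y)$ and $f\colon X\to Y$, $f^\sharp\colon TX\to Y$ is the unique $F$-algebra morphism $(TX,\gamma_X)\to(Y,y)$ with $f^\sharp\circ\eta_X=f$. $I$ and $O$ are fixed objects, and $F_I=I+F(-)$. Automata. An automaton $\mathcal{A}=(Q,\delta,i,o)$ consists of an object $Q$ and morphisms $\delta\colon FQ\to Q$, $i\colon I\to Q$, $o\colon Q\to O$. A homomorphism $\mathcal{A}\to\mathcal{A}'=(Q',\delta',i',o')$ is $h\colon Q\to Q'$ with $\delta'\circ Fh=h\circ\delta$, $h\circ i=i'$, $o'\circ h=o$. The language of $\mathcal{A}$ is $\mathcal{L}_\mathcal{A}=o\circ i^\sharp\colon TI\to O$. $\mathcal{A}$ is reachable if $i^\sharp\in\mathcal{E}$; it is minimal if it is reachable and every reachable automaton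 $\mathcal{A}'$ with $\mathcal{L}_{\mathcal{A}'}=\mathcal{L}_\mathcal{A}$ admits a (necessarily unique) homomorphism to $\mathcal{A}$. Recursive coalgebras. A coalgebra $\rho\colon S\to F_I S$ is recursive if for every algebra $x\colon F_I X\to X$ there is a unique $x^\rho\colon S\to X$ with $x^\rho=x\circ F_I x^\rho\circ\rho$. The $\rho$-language of $\mathcal{A}$ is $\mathcal{L}^\rho_\mathcal{A}=o\circ[i,\delta]^\rho\colon S\to O$. Wrappers. A wrapper for $Q$ is a pair $\mathcal{W}=(\alpha\colon S\to Q,\ \beta\colon Q\to P)$; write $\beta\circ\alpha=m_\mathcal{W}\circ e_\mathcal{W}$ for its $(\mathcal{E},\mathcal{M})$-factorisation, through $H_\mathcal{W}$. For $Q$ the state space of $(Q,\delta,i,o)$: - $\mathcal{W}$ is closed if there are $i_\mathcal{W}\colon I\to H_\mathcal{W}$ and $\mathsf{close}_\mathcal{W}\colon FS\to H_\mathcal{W}$ with $m_\mathcal{W}\circ i_\mathcal{W}=\beta\circ i$ and $m_\mathcal{W}\circ\mathsf{close}_\mathcal{W}=\beta\circ\delta\circ F\alpha$; - $\mathcal{W}$ is consistent if there are $o_\mathcal{W}\colon H_\mathcal{W}\to O$ and $\mathsf{cons}_\mathcal{W}\colon FH_\mathcal{W}\to P$ with $o_\mathcal{W}\circ e_\mathcal{W}=o\circ\alpha$ and $\mathsf{cons}_\mathcal{W}\circ Fe_\mathcal{W}=\beta\circ\delta\circ F\alpha$. A closed and consistent $\mathcal{W}$ induces the hypothesis automaton $\mathcal{H}_\mathcal{W}=(H_\mathcal{W},\delta_\mathcal{W},i_\mathcal{W},o_\mathcal{W})$,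 with $\delta_\mathcal{W}$ the unique diagonal satisfying $\delta_\mathcal{W}\circ Fe_\mathcal{W}=\mathsf{close}_\mathcal{W}$, $m_\mathcal{W}\circ\delta_\mathcal{W}=\mathsf{cons}_\mathcal{W}$. Correctness and counterexamples (target $\mathcal{A}_\mathsf{t}$). A closed and consistent wrapper $\mathcal{W}$ for $Q_\mathsf{t}$ is correct up to a recursive $\rho$ if $\mathcal{L}^\rho_{\mathcal{H}_\mathcal{W}}=\mathcal{L}^\rho_{\mathcal{A}_\mathsf{t}}$; a counterexample for $\mathcal{W}$ is a recursive $\rho\colon S\to F_I S$ such that $\mathcal{W}$ is not correct up to $\rho$. Order. A subobject of $Q_\mathsf{t}$ is a morphism in $\mathcal{M}$ with codomain $Q_\mathsf{t}$; $j\le k$ iff $j=k\circ f$ for some $f$. A quotient of $Q_\mathsf{t}$ is a morphism in $\mathcal{E}$ with domain $Q_\mathsf{t}$; $x\le y$ iff $y=g\circ x$ for some $g$. Local closedness and consistency. Let $\mathcal{W}=(\alpha'\colon S'\to Q_\mathsf{t},\ \beta'\colon Q_\mathsf{t}\to P')$. - $\mathcal{W}$ is locally closed w.r.t. $\alpha\colon S\to Q_\mathsf{t}$ if $\alpha^\triangleleft\le\alpha'^\triangleleft$ and there are $i_\mathcal{W}\colon I\to H_\mathcal{W}$, $\mathsf{lclose}_{\mathcal{W},\alpha}\colon FS\to H_\mathcal{W}$ with $m_\mathcal{W}\circ i_\mathcal{W}=\beta'\circ i_\mathsf{t}$ and $m_\mathcal{W}\circ\mathsf{lclose}_{\mathcal{W},\alpha}=\beta'\circ\delta_\mathsf{t}\circ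 F\alpha$. - $\mathcal{W}$ is locally consistent w.r.t. $\beta\colon Q_\mathsf{t}\to P$ if $\beta'^\triangleright\le\beta^\triangleright$ and there are $o_\mathcal{W}\colon H_\mathcal{W}\to O$, $\mathsf{lcons}_{\mathcal{W},\beta}\colon FH_\mathcal{W}\to P$ with $o_\mathcal{W}\circ e_\mathcal{W}=o_\mathsf{t}\circ\alpha'$ and $\mathsf{lcons}_{\mathcal{W},\beta}\circ Fe_\mathcal{W}=\beta\circ\delta_\mathsf{t}\circ F\alpha'$. Runs. A run is a sequence of wrappers $\mathcal{W}_n=(\alpha_n,\beta_n)$, $n\in\mathbb{N}$, for $Q_\mathsf{t}$ such that: 1. $\alpha_0\colon 0\to Q_\mathsf{t}$ and $\beta_0\colon Q_\mathsf{t}\to 1$ are the unique morphisms; 2. if $\mathcal{W}_n$ is not closed, then $\beta_{n+1}=\beta_n$ and $(\alpha_{n+1},\beta_n)$ is locally closed w.r.t. $\alpha_n$; 3. if $\mathcal{W}_n$ is closed but not consistent, then $\alpha_{n+1}=\alpha_n$ and $(\alpha_n,\beta_{n+1})$ is locally consistent w.r.t. $\beta_n$; 4. if $\mathcal{W}_n$ is closed and consistent but not correct up to all recursive $F_I$-coalgebras, then for some counterexample $\rho\colon S\to F_I S$ for $\mathcal{W}_n$ we have $\alpha_{n+1}^\triangleleft=[\alpha_n,[i_\mathsf{t},\delta_\mathsf{t}]^\rho]^\triangleleft$ (as subobjects of $Q_\mathsf{t}$) and $\beta_{n+1}=\beta_n$; 5. if $\mathcal{W}_n$ is closed and consistent and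 correct up to all recursive $F_I$-coalgebras, then $\mathcal{W}_{n+1}=\mathcal{W}_n$. *)

theory Defs
  imports Main
begin

section \<open>Categories\<close>

record ('o, 'm) category =
  Obj :: "'o set"
  Arr :: "'m set"
  Dom :: "'m \<Rightarrow> 'o"
  Cod :: "'m \<Rightarrow> 'o"
  Id :: "'o \<Rightarrow> 'm"
  Comp :: "'m \<Rightarrow> 'm \<Rightarrow> 'm"  (infixl "\<cdot>\<index>" 70)

definition Hom :: "('o, 'm, 'x) category_scheme \<Rightarrow> 'o \<Rightarrow> 'o \<Rightarrow> 'm set" where
  "Hom C X Y = {f \<in> Arr C. Dom C f = X \<and> Cod C f = Y}"

locale category =
  fixes C (structure)
  assumes Dom_Obj: "f \<in> Arr C \<Longrightarrow> Dom C f \<in> Obj C"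
    and Cod_Obj: "f \<in> Arr C \<Longrightarrow> Cod C f \<in> Obj C"
    and Id_Hom: "X \<in> Obj C \<Longrightarrow> Id C X \<in> Hom C X X"
    and Comp_Hom: "f \<in> Hom C X Y \<Longrightarrow> g \<in> Hom C Y Z \<Longrightarrow> g \<cdot> f \<in> Hom C X Z"
    and Comp_assoc: "f \<in> Hom C W X \<Longrightarrow> g \<in> Hom C X Y \<Longrightarrow> h \<in> Hom C Y Z \<Longrightarrow>
      h \<cdot> g \<cdot> f = h \<cdot> (g \<cdot> f)"
    and Id_left: "f \<in> Hom C X Y \<Longrightarrow> Id C Y \<cdot> f = f"
    and Id_right: "f \<in> Hom C X Y \<Longrightarrow> f \<cdot> Id C X = f"

definition iso :: "('o, 'm, 'x) category_scheme \<Rightarrow> 'm \<Rightarrow> bool" where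
  "iso C f \<longleftrightarrow> f \<in> Arr C \<and>
    (\<exists>g \<in> Hom C (Cod C f) (Dom C f).
       g \<cdot>\<^bsub>C\<^esub> f = Id C (Dom C f) \<and> f \<cdot>\<^bsub>C\<^esub> g = Id C (Cod C f))"

definition epi :: "('o, 'm, 'x) category_scheme \<Rightarrow> 'm \<Rightarrow> bool" where
  "epi C f \<longleftrightarrow> f \<in> Arr C \<and>
    (\<forall>Z \<in> Obj C. \<forall>g \<in> Hom C (Cod C f) Z. \<forall>h \<in> Hom C (Cod C f) Z.
       g \<cdot>\<^bsub>C\<^esub> f = h \<cdot>\<^bsub>C\<^esub> f \<longrightarrow> g = h)"

definition mono :: "('o, 'm, 'x) category_scheme \<Rightarrow> 'm \<Rightarrow> bool" where
  "mono C f \<longleftrightarrow> f \<in> Arr C \<and>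
    (\<forall>Z \<in> Obj C. \<forall>g \<in> Hom C Z (Dom C f). \<forall>h \<in> Hom C Z (Dom C f).
       f \<cdot>\<^bsub>C\<^esub> g = f \<cdot>\<^bsub>C\<^esub> h \<longrightarrow> g = h)"

text \<open>Finite products and coproducts are given by a terminal and an initial object together with
  chosen binary products and coproducts.\<close>

record ('o, 'm) bicartesian_category = "('o, 'm) category" +
  Init :: 'o
  Term :: 'o
  Prod :: "'o \<Rightarrow> 'o \<Rightarrow> 'o"
  Pr1 :: "'o \<Rightarrow> 'o \<Rightarrow> 'm"
  Pr2 :: "'o \<Rightarrow> 'o \<Rightarrow> 'm"
  Coprod :: "'o \<Rightarrow> 'o \<Rightarrow> 'o"
  In1 :: "'o \<Rightarrow> 'o \<Rightarrow> 'm"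
  In2 :: "'o \<Rightarrow> 'o \<Rightarrow> 'm"

locale bicartesian_category = category C for C (structure) +
  assumes Init_Obj: "Init C \<in> Obj C"
    and Init_universal: "X \<in> Obj C \<Longrightarrow> \<exists>!f. f \<in> Hom C (Init C) X"
    and Term_Obj: "Term C \<in> Obj C"
    and Term_universal: "X \<in> Obj C \<Longrightarrow> \<exists>!f. f \<in> Hom C X (Term C)"
    and Prod_Obj: "X \<in> Obj C \<Longrightarrow> Y \<in> Obj C \<Longrightarrow> Prod C X Y \<in> Obj C"
    and Pr1_Hom: "X \<in> Obj C \<Longrightarrow> Y \<in> Obj C \<Longrightarrow> Pr1 C X Y \<in> Hom C (Prod C X Y) X"
    and Pr2_Hom: "X \<in> Obj C \<Longrightarrow> Y \<in> Obj C \<Longrightarrow> Pr2 C X Y \<in> Hom C (Prod C X Y) Y"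
    and Prod_universal: "X \<in> Obj C \<Longrightarrow> Y \<in> Obj C \<Longrightarrow> f \<in> Hom C Z X \<Longrightarrow> g \<in> Hom C Z Y \<Longrightarrow>
      \<exists>!h. h \<in> Hom C Z (Prod C X Y) \<and> Pr1 C X Y \<cdot> h = f \<and> Pr2 C X Y \<cdot> h = g"
    and Coprod_Obj: "X \<in> Obj C \<Longrightarrow> Y \<in> Obj C \<Longrightarrow> Coprod C X Y \<in> Obj C"
    and In1_Hom: "X \<in> Obj C \<Longrightarrow> Y \<in> Obj C \<Longrightarrow> In1 C X Y \<in> Hom C X (Coprod C X Y)"
    and In2_Hom: "X \<in> Obj C \<Longrightarrow> Y \<in> Obj C \<Longrightarrow> In2 C X Y \<in> Hom C Y (Coprod C X Y)"
    and Coprod_universal: "X \<in> Obj C \<Longrightarrow> Y \<in> Obj C \<Longrightarrow> f \<in> Hom C X Z \<Longrightarrow> g \<in> Hom C Y Z \<Longrightarrow>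
      \<exists>!h. h \<in> Hom C (Coprod C X Y) Z \<and> h \<cdot> In1 C X Y = f \<and> h \<cdot> In2 C X Y = g"

definition cotuple :: "('o, 'm, 'x) bicartesian_category_scheme \<Rightarrow> 'm \<Rightarrow> 'm \<Rightarrow> 'm" where
  "cotuple C f g = (THE h. h \<in> Hom C (Coprod C (Dom C f) (Dom C g)) (Cod C f) \<and>
     h \<cdot>\<^bsub>C\<^esub> In1 C (Dom C f) (Dom C g) = f \<and> h \<cdot>\<^bsub>C\<^esub> In2 C (Dom C f) (Dom C g) = g)"

section \<open>Factorisation systems\<close>

text \<open>\<open>EPart C f\<close> and \<open>MPart C f\<close> are the chosen components \<open>f\<^sup>\<triangleright>\<close> and \<open>f\<^sup>\<triangleleft>\<close> of the
  factorisation of \<open>f\<close>; they are determined only up to isomorphism.\<close>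

record ('o, 'm) factorisation_category = "('o, 'm) bicartesian_category" +
  EE :: "'m set"
  MM :: "'m set"
  EPart :: "'m \<Rightarrow> 'm"
  MPart :: "'m \<Rightarrow> 'm"

locale factorisation_category = bicartesian_category C for C (structure) +
  assumes EE_Arr: "EE C \<subseteq> Arr C"
    and MM_Arr: "MM C \<subseteq> Arr C"
    and EE_iso_left: "e \<in> EE C \<Longrightarrow> iso C u \<Longrightarrow> Dom C u = Cod C e \<Longrightarrow> u \<cdot> e \<in> EE C"
    and EE_iso_right: "e \<in> EE C \<Longrightarrow> iso C u \<Longrightarrow> Cod C u = Dom C e \<Longrightarrow> e \<cdot> u \<in> EE C"
    and MM_iso_left: "m \<in> MM C \<Longrightarrow> iso C u \<Longrightarrow> Dom C u = Cod C m \<Longrightarrow> u \<cdot> m \<in> MM C"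
    and MM_iso_right: "m \<in> MM C \<Longrightarrow> iso C u \<Longrightarrow> Cod C u = Dom C m \<Longrightarrow> m \<cdot> u \<in> MM C"
    and EPart_EE: "f \<in> Arr C \<Longrightarrow> EPart C f \<in> EE C"
    and MPart_MM: "f \<in> Arr C \<Longrightarrow> MPart C f \<in> MM C"
    and Dom_EPart: "f \<in> Arr C \<Longrightarrow> Dom C (EPart C f) = Dom C f"
    and Cod_EPart: "f \<in> Arr C \<Longrightarrow> Cod C (EPart C f) = Dom C (MPart C f)"
    and Cod_MPart: "f \<in> Arr C \<Longrightarrow> Cod C (MPart C f) = Cod C f"
    and factorisation: "f \<in> Arr C \<Longrightarrow> MPart C f \<cdot> EPart C f = f"
    and diagonal: "e \<in> EE C \<Longrightarrow> m \<in> MM C \<Longrightarrow>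
      u \<in> Hom C (Dom C e) (Dom C m) \<Longrightarrow> v \<in> Hom C (Cod C e) (Cod C m) \<Longrightarrow> m \<cdot> u = v \<cdot> e \<Longrightarrow>
      \<exists>!d. d \<in> Hom C (Cod C e) (Dom C m) \<and> d \<cdot> e = u \<and> m \<cdot> d = v"
    and EE_epi: "e \<in> EE C \<Longrightarrow> epi C e"
    and MM_mono: "m \<in> MM C \<Longrightarrow> mono C m"

definition subobjects :: "('o, 'm, 'x) factorisation_category_scheme \<Rightarrow> 'o \<Rightarrow> 'm set" where
  "subobjects C Q = {j \<in> MM C. Cod C j = Q}"

definition sub_le :: "('o, 'm, 'x) factorisation_category_scheme \<Rightarrow> 'm \<Rightarrow> 'm \<Rightarrow> bool" where
  "sub_le C j k \<longleftrightarrow> (\<exists>f \<in> Hom C (Dom C j) (Dom C k). j = k \<cdot>\<^bsub>C\<^esub> f)"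

definition sub_iso :: "('o, 'm, 'x) factorisation_category_scheme \<Rightarrow> 'm \<Rightarrow> 'm \<Rightarrow> bool" where
  "sub_iso C j k \<longleftrightarrow> (\<exists>f \<in> Hom C (Dom C j) (Dom C k). iso C f \<and> j = k \<cdot>\<^bsub>C\<^esub> f)"

definition quotients :: "('o, 'm, 'x) factorisation_category_scheme \<Rightarrow> 'o \<Rightarrow> 'm set" where
  "quotients C Q = {x \<in> EE C. Dom C x = Q}"

definition quot_le :: "('o, 'm, 'x) factorisation_category_scheme \<Rightarrow> 'm \<Rightarrow> 'm \<Rightarrow> bool" where
  "quot_le C x y \<longleftrightarrow> (\<exists>g \<in> Hom C (Cod C x) (Cod C y). y = g \<cdot>\<^bsub>C\<^esub> x)"

definition quot_iso :: "('o, 'm, 'x) factorisation_category_scheme \<Rightarrow> 'm \<Rightarrow> 'm \<Rightarrow> bool" where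
  "quot_iso C x y \<longleftrightarrow> (\<exists>g \<in> Hom C (Cod C x) (Cod C y). iso C g \<and> y = g \<cdot>\<^bsub>C\<^esub> x)"

definition finitely_many_subobjects ::
    "('o, 'm, 'x) factorisation_category_scheme \<Rightarrow> 'o \<Rightarrow> bool" where
  "finitely_many_subobjects C Q \<longleftrightarrow>
     finite (subobjects C Q // {(j, k) \<in> subobjects C Q \<times> subobjects C Q. sub_iso C j k})"

definition finitely_many_quotients ::
    "('o, 'm, 'x) factorisation_category_scheme \<Rightarrow> 'o \<Rightarrow> bool" where
  "finitely_many_quotients C Q \<longleftrightarrow>
     finite (quotients C Q // {(x, y) \<in> quotients C Q \<times> quotients C Q. quot_iso C x y})"

section \<open>Varietors, automata and recursive coalgebras\<close>

text \<open>\<open>FObj\<close>, \<open>FArr\<close> are the actions of \<open>F\<close>. The free algebra monad is given by its objects \<open>TObj\<close>,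
  units \<open>eta\<close> and free algebra structures \<open>gamma\<close>; its action on morphisms and its multiplication
  are determined by the universal property of the free algebras.\<close>

record ('o, 'm) learning_category = "('o, 'm) factorisation_category" +
  FObj :: "'o \<Rightarrow> 'o"
  FArr :: "'m \<Rightarrow> 'm"
  TObj :: "'o \<Rightarrow> 'o"
  eta :: "'o \<Rightarrow> 'm"
  gamma :: "'o \<Rightarrow> 'm"
  InpObj :: 'o
  OutObj :: 'o

locale learning_category = factorisation_category C for C (structure) +
  assumes FObj_Obj: "X \<in> Obj C \<Longrightarrow> FObj C X \<in> Obj C"
    and FArr_Hom: "f \<in> Hom C X Y \<Longrightarrow> FArr C f \<in> Hom C (FObj C X) (FObj C Y)"
    and FArr_Id: "X \<in> Obj C \<Longrightarrow> FArr C (Id C X) = Id C (FObj C X)"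
    and FArr_Comp: "f \<in> Hom C X Y \<Longrightarrow> g \<in> Hom C Y Z \<Longrightarrow> FArr C (g \<cdot> f) = FArr C g \<cdot> FArr C f"
    and FArr_EE: "e \<in> EE C \<Longrightarrow> FArr C e \<in> EE C"
    and TObj_Obj: "X \<in> Obj C \<Longrightarrow> TObj C X \<in> Obj C"
    and eta_Hom: "X \<in> Obj C \<Longrightarrow> eta C X \<in> Hom C X (TObj C X)"
    and gamma_Hom: "X \<in> Obj C \<Longrightarrow> gamma C X \<in> Hom C (FObj C (TObj C X)) (TObj C X)"
    and free_universal: "X \<in> Obj C \<Longrightarrow> Y \<in> Obj C \<Longrightarrow>
      y \<in> Hom C (FObj C Y) Y \<Longrightarrow> f \<in> Hom C X Y \<Longrightarrow>
      \<exists>!g. g \<in> Hom C (TObj C X) Y \<and> g \<cdot> gamma C X = y \<cdot> FArr C g \<and> g \<cdot> eta C X = f"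
    and InpObj_Obj: "InpObj C \<in> Obj C"
    and OutObj_Obj: "OutObj C \<in> Obj C"

text \<open>The extension \<open>f\<^sup>\<sharp>\<close> of \<open>f\<close> with respect to the algebra structure \<open>y\<close>.\<close>

definition sharp :: "('o, 'm, 'x) learning_category_scheme \<Rightarrow> 'm \<Rightarrow> 'm \<Rightarrow> 'm" where
  "sharp C y f = (THE g. g \<in> Hom C (TObj C (Dom C f)) (Cod C f) \<and>
     g \<cdot>\<^bsub>C\<^esub> gamma C (Dom C f) = y \<cdot>\<^bsub>C\<^esub> FArr C g \<and> g \<cdot>\<^bsub>C\<^esub> eta C (Dom C f) = f)"

record ('o, 'm) automaton =
  State :: 'o
  delta :: 'm
  init :: 'm
  out :: 'm

definition automaton ::
    "('o, 'm, 'x) learning_category_scheme \<Rightarrow> ('o, 'm) automaton \<Rightarrow> bool" where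
  "automaton C A \<longleftrightarrow> State A \<in> Obj C \<and>
     delta A \<in> Hom C (FObj C (State A)) (State A) \<and>
     init A \<in> Hom C (InpObj C) (State A) \<and>
     out A \<in> Hom C (State A) (OutObj C)"

definition automaton_hom ::
    "('o, 'm, 'x) learning_category_scheme \<Rightarrow> ('o, 'm) automaton \<Rightarrow> ('o, 'm) automaton \<Rightarrow> 'm set"
where
  "automaton_hom C A A' = {h \<in> Hom C (State A) (State A').
     delta A' \<cdot>\<^bsub>C\<^esub> FArr C h = h \<cdot>\<^bsub>C\<^esub> delta A \<and>
     h \<cdot>\<^bsub>C\<^esub> init A = init A' \<and> out A' \<cdot>\<^bsub>C\<^esub> h = out A}"

definition language ::
    "('o, 'm, 'x) learning_category_scheme \<Rightarrow> ('o, 'm) automaton \<Rightarrow> 'm" where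
  "language C A = out A \<cdot>\<^bsub>C\<^esub> sharp C (delta A) (init A)"

definition reachable ::
    "('o, 'm, 'x) learning_category_scheme \<Rightarrow> ('o, 'm) automaton \<Rightarrow> bool" where
  "reachable C A \<longleftrightarrow> automaton C A \<and> sharp C (delta A) (init A) \<in> EE C"

definition minimal ::
    "('o, 'm, 'x) learning_category_scheme \<Rightarrow> ('o, 'm) automaton \<Rightarrow> bool" where
  "minimal C A \<longleftrightarrow> reachable C A \<and>
     (\<forall>A'. reachable C A' \<and> language C A' = language C A \<longrightarrow>
        automaton_hom C A' A \<noteq> {})"

definition FIObj :: "('o, 'm, 'x) learning_category_scheme \<Rightarrow> 'o \<Rightarrow> 'o" where
  "FIObj C X = Coprod C (InpObj C) (FObj C X)"

definition FIArr :: "('o, 'm, 'x) learning_category_scheme \<Rightarrow> 'm \<Rightarrow> 'm" where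
  "FIArr C f = cotuple C
     (In1 C (InpObj C) (FObj C (Cod C f)))
     (In2 C (InpObj C) (FObj C (Cod C f)) \<cdot>\<^bsub>C\<^esub> FArr C f)"

definition recursive ::
    "('o, 'm, 'x) learning_category_scheme \<Rightarrow> 'o \<Rightarrow> 'm \<Rightarrow> bool" where
  "recursive C S \<rho> \<longleftrightarrow> S \<in> Obj C \<and> \<rho> \<in> Hom C S (FIObj C S) \<and>
     (\<forall>X \<in> Obj C. \<forall>x \<in> Hom C (FIObj C X) X.
        \<exists>!h. h \<in> Hom C S X \<and> h = x \<cdot>\<^bsub>C\<^esub> FIArr C h \<cdot>\<^bsub>C\<^esub> \<rho>)"

text \<open>The unique coalgebra-to-algebra morphism \<open>x\<^sup>\<rho>\<close>.\<close>

definition rec_ext ::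
    "('o, 'm, 'x) learning_category_scheme \<Rightarrow> 'm \<Rightarrow> 'm \<Rightarrow> 'm" where
  "rec_ext C \<rho> x = (THE h. h \<in> Hom C (Dom C \<rho>) (Cod C x) \<and> h = x \<cdot>\<^bsub>C\<^esub> FIArr C h \<cdot>\<^bsub>C\<^esub> \<rho>)"

definition rec_language ::
    "('o, 'm, 'x) learning_category_scheme \<Rightarrow> 'm \<Rightarrow> ('o, 'm) automaton \<Rightarrow> 'm" where
  "rec_language C \<rho> A = out A \<cdot>\<^bsub>C\<^esub> rec_ext C \<rho> (cotuple C (init A) (delta A))"

section \<open>Wrappers\<close>

definition wrapper ::
    "('o, 'm, 'x) learning_category_scheme \<Rightarrow> 'o \<Rightarrow> 'm \<times> 'm \<Rightarrow> bool" where
  "wrapper C Q W \<longleftrightarrow> fst W \<in> Arr C \<and> Cod C (fst W) = Q \<and> snd W \<in> Arr C \<and> Dom C (snd W) = Q"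

definition e_wrap :: "('o, 'm, 'x) learning_category_scheme \<Rightarrow> 'm \<times> 'm \<Rightarrow> 'm" where
  "e_wrap C W = EPart C (snd W \<cdot>\<^bsub>C\<^esub> fst W)"

definition m_wrap :: "('o, 'm, 'x) learning_category_scheme \<Rightarrow> 'm \<times> 'm \<Rightarrow> 'm" where
  "m_wrap C W = MPart C (snd W \<cdot>\<^bsub>C\<^esub> fst W)"

definition H_wrap :: "('o, 'm, 'x) learning_category_scheme \<Rightarrow> 'm \<times> 'm \<Rightarrow> 'o" where
  "H_wrap C W = Cod C (e_wrap C W)"

text \<open>The predicates below say when a morphism is the mediating morphism \<open>i\<^sub>W\<close>, \<open>o\<^sub>W\<close>,
  \<open>(l)close\<^sub>W\<close>, \<open>(l)cons\<^sub>W\<close>. In the last two, \<open>\<alpha>\<close> and \<open>\<beta>\<close> are the components of \<open>W\<close> itself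
  for (global) closedness and consistency, and those of another wrapper for the local versions.\<close>

definition is_init_wrap ::
    "('o, 'm, 'x) learning_category_scheme \<Rightarrow> ('o, 'm) automaton \<Rightarrow>
       'm \<times> 'm \<Rightarrow> 'm \<Rightarrow> bool"
where
  "is_init_wrap C A W k \<longleftrightarrow> k \<in> Hom C (InpObj C) (H_wrap C W) \<and>
     m_wrap C W \<cdot>\<^bsub>C\<^esub> k = snd W \<cdot>\<^bsub>C\<^esub> init A"

definition is_out_wrap ::
    "('o, 'm, 'x) learning_category_scheme \<Rightarrow> ('o, 'm) automaton \<Rightarrow>
       'm \<times> 'm \<Rightarrow> 'm \<Rightarrow> bool"
where
  "is_out_wrap C A W k \<longleftrightarrow> k \<in> Hom C (H_wrap C W) (OutObj C) \<and>
     k \<cdot>\<^bsub>C\<^esub> e_wrap C W = out A \<cdot>\<^bsub>C\<^esub> fst W"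

definition is_close ::
    "('o, 'm, 'x) learning_category_scheme \<Rightarrow> ('o, 'm) automaton \<Rightarrow>
       'm \<times> 'm \<Rightarrow> 'm \<Rightarrow> 'm \<Rightarrow> bool"
where
  "is_close C A W \<alpha> k \<longleftrightarrow> k \<in> Hom C (FObj C (Dom C \<alpha>)) (H_wrap C W) \<and>
     m_wrap C W \<cdot>\<^bsub>C\<^esub> k = snd W \<cdot>\<^bsub>C\<^esub> delta A \<cdot>\<^bsub>C\<^esub> FArr C \<alpha>"

definition is_cons ::
    "('o, 'm, 'x) learning_category_scheme \<Rightarrow> ('o, 'm) automaton \<Rightarrow>
       'm \<times> 'm \<Rightarrow> 'm \<Rightarrow> 'm \<Rightarrow> bool"
where
  "is_cons C A W \<beta> k \<longleftrightarrow> k \<in> Hom C (FObj C (H_wrap C W)) (Cod C \<beta>) \<and>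
     k \<cdot>\<^bsub>C\<^esub> FArr C (e_wrap C W) = \<beta> \<cdot>\<^bsub>C\<^esub> delta A \<cdot>\<^bsub>C\<^esub> FArr C (fst W)"

definition closed ::
    "('o, 'm, 'x) learning_category_scheme \<Rightarrow> ('o, 'm) automaton \<Rightarrow>
       'm \<times> 'm \<Rightarrow> bool"
where
  "closed C A W \<longleftrightarrow> wrapper C (State A) W \<and>
     (\<exists>k. is_init_wrap C A W k) \<and> (\<exists>k. is_close C A W (fst W) k)"

definition consistent ::
    "('o, 'm, 'x) learning_category_scheme \<Rightarrow> ('o, 'm) automaton \<Rightarrow>
       'm \<times> 'm \<Rightarrow> bool"
where
  "consistent C A W \<longleftrightarrow> wrapper C (State A) W \<and>
     (\<exists>k. is_out_wrap C A W k) \<and> (\<exists>k. is_cons C A W (snd W) k)"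

definition locally_closed ::
    "('o, 'm, 'x) learning_category_scheme \<Rightarrow> ('o, 'm) automaton \<Rightarrow>
       'm \<times> 'm \<Rightarrow> 'm \<Rightarrow> bool"
where
  "locally_closed C A W \<alpha> \<longleftrightarrow> wrapper C (State A) W \<and>
     \<alpha> \<in> Arr C \<and> Cod C \<alpha> = State A \<and> sub_le C (MPart C \<alpha>) (MPart C (fst W)) \<and>
     (\<exists>k. is_init_wrap C A W k) \<and> (\<exists>k. is_close C A W \<alpha> k)"

definition locally_consistent ::
    "('o, 'm, 'x) learning_category_scheme \<Rightarrow> ('o, 'm) automaton \<Rightarrow>
       'm \<times> 'm \<Rightarrow> 'm \<Rightarrow> bool"
where
  "locally_consistent C A W \<beta> \<longleftrightarrow> wrapper C (State A) W \<and>
     \<beta> \<in> Arr C \<and> Dom C \<beta> = State A \<and> quot_le C (EPart C (snd W)) (EPart C \<beta>) \<and>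
     (\<exists>k. is_out_wrap C A W k) \<and> (\<exists>k. is_cons C A W \<beta> k)"

text \<open>For a closed and consistent wrapper all the descriptions below are of unique morphisms;
  for other wrappers the hypothesis is unspecified.\<close>

definition hypothesis ::
    "('o, 'm, 'x) learning_category_scheme \<Rightarrow> ('o, 'm) automaton \<Rightarrow> 'm \<times> 'm \<Rightarrow> ('o, 'm) automaton"
where
  "hypothesis C A W = \<lparr>
     State = H_wrap C W,
     delta = (THE d. d \<in> Hom C (FObj C (H_wrap C W)) (H_wrap C W) \<and>
       d \<cdot>\<^bsub>C\<^esub> FArr C (e_wrap C W) = (THE k. is_close C A W (fst W) k) \<and>
       m_wrap C W \<cdot>\<^bsub>C\<^esub> d = (THE k. is_cons C A W (snd W) k)),
     init = (THE k. is_init_wrap C A W k),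
     out = (THE k. is_out_wrap C A W k)\<rparr>"

definition correct_up_to ::
    "('o, 'm, 'x) learning_category_scheme \<Rightarrow> ('o, 'm) automaton \<Rightarrow>
       'm \<times> 'm \<Rightarrow> 'm \<Rightarrow> bool"
where
  "correct_up_to C A W \<rho> \<longleftrightarrow> rec_language C \<rho> (hypothesis C A W) = rec_language C \<rho> A"

definition counterexample ::
    "('o, 'm, 'x) learning_category_scheme \<Rightarrow> ('o, 'm) automaton \<Rightarrow>
       'm \<times> 'm \<Rightarrow> 'o \<Rightarrow> 'm \<Rightarrow> bool"
where
  "counterexample C A W S \<rho> \<longleftrightarrow> recursive C S \<rho> \<and> \<not> correct_up_to C A W \<rho>"

definition correct_up_to_all ::
    "('o, 'm, 'x) learning_category_scheme \<Rightarrow> ('o, 'm) automaton \<Rightarrow>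
       'm \<times> 'm \<Rightarrow> bool"
where
  "correct_up_to_all C A W \<longleftrightarrow> (\<forall>S \<rho>. recursive C S \<rho> \<longrightarrow> correct_up_to C A W \<rho>)"

section \<open>Runs\<close>

definition run ::
    "('o, 'm, 'x) learning_category_scheme \<Rightarrow> ('o, 'm) automaton \<Rightarrow> (nat \<Rightarrow> 'm \<times> 'm) \<Rightarrow> bool"
where
  "run C A W \<longleftrightarrow>
     (\<forall>n. wrapper C (State A) (W n)) \<and>
     fst (W 0) \<in> Hom C (Init C) (State A) \<and> snd (W 0) \<in> Hom C (State A) (Term C) \<and>
     (\<forall>n. \<not> closed C A (W n) \<longrightarrow>
        snd (W (Suc n)) = snd (W n) \<and>
        locally_closed C A (fst (W (Suc n)), snd (W n)) (fst (W n))) \<and>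
     (\<forall>n. closed C A (W n) \<and> \<not> consistent C A (W n) \<longrightarrow>
        fst (W (Suc n)) = fst (W n) \<and>
        locally_consistent C A (fst (W n), snd (W (Suc n))) (snd (W n))) \<and>
     (\<forall>n. closed C A (W n) \<and> consistent C A (W n) \<and> \<not> correct_up_to_all C A (W n) \<longrightarrow>
        (\<exists>S \<rho>. counterexample C A (W n) S \<rho> \<and>
           sub_iso C (MPart C (fst (W (Suc n))))
             (MPart C (cotuple C (fst (W n)) (rec_ext C \<rho> (cotuple C (init A) (delta A)))))) \<and>
        snd (W (Suc n)) = snd (W n)) \<and>
     (\<forall>n. closed C A (W n) \<and> consistent C A (W n) \<and> correct_up_to_all C A (W n) \<longrightarrow>
        W (Suc n) = W n)"

definition correct_hypothesis ::
    "('o, 'm, 'x) learning_category_scheme \<Rightarrow> ('o, 'm) automaton \<Rightarrow>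
       'm \<times> 'm \<Rightarrow> bool"
where
  "correct_hypothesis C A W \<longleftrightarrow> closed C A W \<and> consistent C A W \<and>
     language C (hypothesis C A W) = language C A"

end

theory Submission
  imports Defs
begin

text \<open>The factorisation of \<open>\<beta>\<alpha>\<close> depends, up to isomorphism, only on the subobject \<open>\<alpha>\<^sup>\<triangleleft>\<close> and the
  quotient \<open>\<beta>\<^sup>\<triangleright>\<close>. Hence a step of a run that leaves both unchanged cannot repair a failure of
  closedness or consistency, and it cannot process a counterexample \<open>\<rho>\<close> either: if \<open>[i, \<delta>]\<^sup>\<rho>\<close> factors
  through \<open>\<alpha>\<^sup>\<triangleleft>\<close>, then the hypothesis is already correct up to \<open>\<rho>\<close>. So every step before correctness
  strictly enlarges \<open>\<alpha>\<^sup>\<triangleleft>\<close> or strictly refines \<open>\<beta>\<^sup>\<triangleright>\<close>. Correctness up to all recursive coalgebras is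
  correctness because the inverse of the initial algebra \<open>I + FTI \<rightarrow> TI\<close> is recursive.

  If \<open>\<alpha> = [i, \<delta>]\<^sup>\<rho>\<close>, then \<open>e\<^sub>W\<close> is the corresponding extension into the hypothesis and factors through
  \<open>TI\<close>, which makes the hypothesis reachable. Minimality of the target gives a homomorphism \<open>k\<close> from
  the hypothesis to the target with \<open>k \<in> \<E>\<close> and \<open>\<beta> k = m\<^sub>W \<in> \<M>\<close>, and then \<open>k\<close> is an isomorphism.\<close>

section \<open>Categories and factorisation systems\<close>

context category
begin

lemma Hom_iff: "f \<in> Hom C X Y \<longleftrightarrow> f \<in> Arr C \<and> Dom C f = X \<and> Cod C f = Y"
  by (simp add: Hom_def)

lemma HomI: "f \<in> Arr C \<Longrightarrow> f \<in> Hom C (Dom C f) (Cod C f)"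
  by (simp add: Hom_iff)

declare Dom_Obj [simp] Cod_Obj [simp]

lemma Comp_Arr_Dom_Cod [simp]:
  assumes "f \<in> Arr C" and "g \<in> Arr C" and "Dom C g = Cod C f"
  shows "g \<cdot> f \<in> Arr C" and "Dom C (g \<cdot> f) = Dom C f" and "Cod C (g \<cdot> f) = Cod C g"
  using Comp_Hom[of f "Dom C f" "Cod C f" g "Cod C g"] assms by (auto simp: Hom_iff)

lemma Id_Arr_Dom_Cod [simp]:
  assumes "X \<in> Obj C"
  shows "Id C X \<in> Arr C" and "Dom C (Id C X) = X" and "Cod C (Id C X) = X"
  using Id_Hom[OF assms] by (auto simp: Hom_iff)

lemma Id_left_Arr [simp]: "f \<in> Arr C \<Longrightarrow> Cod C f = X \<Longrightarrow> Id C X \<cdot> f = f"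
  using Id_left HomI by blast

lemma Id_right_Arr [simp]: "f \<in> Arr C \<Longrightarrow> Dom C f = X \<Longrightarrow> f \<cdot> Id C X = f"
  using Id_right HomI by blast

lemma Comp_assoc_Arr [simp]:
  assumes "f \<in> Arr C" and "g \<in> Arr C" and "h \<in> Arr C" and "Dom C g = Cod C f" and "Dom C h = Cod C g"
  shows "h \<cdot> g \<cdot> f = h \<cdot> (g \<cdot> f)"
  using Comp_assoc[of f "Dom C f" "Cod C f" g "Cod C g" h "Cod C h"] assms by (auto simp: Hom_iff)

text \<open>Composites are normalised to nest to the right, which hides \<open>h \<cdot> g\<close>
  inside \<open>h \<cdot> (g \<cdot> f)\<close>. This form applies an equation between composites at
  the head of such a chain.\<close>

lemma Comp_reassoc:
  assumes "h \<cdot> g = k" and "f \<in> Arr C" and "g \<in> Arr C" and "h \<in> Arr C"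
    and "Dom C g = Cod C f" and "Dom C h = Cod C g"
  shows "h \<cdot> (g \<cdot> f) = k \<cdot> f"
  using Comp_assoc_Arr[OF assms(2-)] assms(1) by simp

lemma mono_cancel:
  assumes "mono C m" and "m \<cdot> f = m \<cdot> g" and "f \<in> Arr C" and "g \<in> Arr C"
    and "Cod C f = Dom C m" and "Cod C g = Dom C m"
  shows "f = g"
proof -
  have m: "m \<in> Arr C"
    using assms(1) by (simp add: mono_def)
  \<comment> \<open>Equal composites have equal domains, so \<open>f\<close> and \<open>g\<close>
    are parallel and the definition of mono applies.\<close>
  have "Dom C f = Dom C g"
    using Comp_Arr_Dom_Cod(2)[of f m] Comp_Arr_Dom_Cod(2)[of g m] m assms by simp
  then have "f \<in> Hom C (Dom C g) (Dom C m)" "g \<in> Hom C (Dom C g) (Dom C m)" "Dom C g \<in> Obj C"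
    using assms by (auto simp: Hom_iff)
  then show ?thesis
    using assms(1,2) unfolding mono_def by blast
qed

lemma epi_cancel:
  assumes "epi C e" and "f \<cdot> e = g \<cdot> e" and "f \<in> Arr C" and "g \<in> Arr C"
    and "Dom C f = Cod C e" and "Dom C g = Cod C e"
  shows "f = g"
proof -
  have e: "e \<in> Arr C"
    using assms(1) by (simp add: epi_def)
  have "Cod C f = Cod C g"
    using Comp_Arr_Dom_Cod(3)[of e f] Comp_Arr_Dom_Cod(3)[of e g] e assms by simp
  then have "f \<in> Hom C (Cod C e) (Cod C g)" "g \<in> Hom C (Cod C e) (Cod C g)" "Cod C g \<in> Obj C"
    using assms by (auto simp: Hom_iff)
  then show ?thesis
    using assms(1,2) unfolding epi_def by blast
qed

lemma iso_Id: "X \<in> Obj C \<Longrightarrow> iso C (Id C X)"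
  by (auto simp: iso_def Hom_iff intro!: bexI[of _ "Id C X"])

end

section \<open>Copairing\<close>

context bicartesian_category
begin

lemma cotuple_props:
  assumes "f \<in> Hom C X Z" and "g \<in> Hom C Y Z"
  shows "cotuple C f g \<in> Hom C (Coprod C X Y) Z"
    and "cotuple C f g \<cdot> In1 C X Y = f"
    and "cotuple C f g \<cdot> In2 C X Y = g"
proof -
  have "X \<in> Obj C" "Y \<in> Obj C"
    using assms by (auto simp: Hom_iff)
  from theI'[OF Coprod_universal[OF this assms]] assms
  show "cotuple C f g \<in> Hom C (Coprod C X Y) Z" "cotuple C f g \<cdot> In1 C X Y = f"
    "cotuple C f g \<cdot> In2 C X Y = g"
    by (auto simp: cotuple_def Hom_iff)
qed

lemma cotuple_eqI:
  assumes "h \<in> Hom C (Coprod C X Y) Z" and "h \<cdot> In1 C X Y = f" and "h \<cdot> In2 C X Y = g"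
    and "X \<in> Obj C" and "Y \<in> Obj C"
  shows "cotuple C f g = h"
proof -
  have "f \<in> Hom C X Z" "g \<in> Hom C Y Z"
    using assms In1_Hom[of X Y] In2_Hom[of X Y] Comp_Hom by blast+
  from Coprod_universal[OF assms(4,5) this] cotuple_props[OF this] assms show ?thesis
    by blast
qed

lemma Comp_cotuple:
  assumes "f \<in> Hom C X Z" and "g \<in> Hom C Y Z" and "h \<in> Hom C Z V"
  shows "h \<cdot> cotuple C f g = cotuple C (h \<cdot> f) (h \<cdot> g)"
proof -
  have X: "X \<in> Obj C" "Y \<in> Obj C"
    using assms by (auto simp: Hom_iff)
  note p = cotuple_props[OF assms(1,2)]
  show ?thesis
    using Comp_Hom[OF p(1) assms(3)] Comp_assoc[OF In1_Hom[OF X] p(1) assms(3)]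
      Comp_assoc[OF In2_Hom[OF X] p(1) assms(3)] p(2,3) X
    by (intro cotuple_eqI[where X = X and Y = Y, symmetric]) auto
qed

end

section \<open>Diagonals and images\<close>

context factorisation_category
begin

lemma EE_in_Arr [simp]: "e \<in> EE C \<Longrightarrow> e \<in> Arr C"
  using EE_Arr by blast

lemma MM_in_Arr [simp]: "m \<in> MM C \<Longrightarrow> m \<in> Arr C"
  using MM_Arr by blast

declare EPart_EE [simp] MPart_MM [simp] Dom_EPart [simp] Cod_EPart [simp] Cod_MPart [simp]
  factorisation [simp]

lemma diagonal_fill_in:
  assumes "e \<in> EE C" and "m \<in> MM C" and "u \<in> Arr C" and "v \<in> Arr C"
    and "Dom C u = Dom C e" and "Cod C u = Dom C m" and "Dom C v = Cod C e" and "Cod C v = Cod C m"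
    and "m \<cdot> u = v \<cdot> e"
  obtains d where "d \<in> Arr C" and "Dom C d = Cod C e" and "Cod C d = Dom C m"
    and "d \<cdot> e = u" and "m \<cdot> d = v"
  using diagonal[of e m u v] assms by (auto simp: Hom_iff)

lemma factorisation_reassoc [simp]:
  "f \<in> Arr C \<Longrightarrow> g \<in> Arr C \<Longrightarrow> Cod C g = Dom C f \<Longrightarrow> MPart C f \<cdot> (EPart C f \<cdot> g) = f \<cdot> g"
  by (simp add: Comp_reassoc[OF factorisation])

text \<open>The diagonal of the square from \<open>g \<cdot> t\<close> to \<open>MPart C g\<close>,
  with an identity at the bottom, is a right inverse of \<open>MPart C g\<close>. A mono with a
  right inverse is an isomorphism, so \<open>g\<close> is \<open>EPart C g\<close> followed by an
  isomorphism.\<close>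

lemma EE_cancel_right:
  assumes "g \<cdot> t \<in> EE C" and "g \<in> Arr C" and "t \<in> Arr C" and "Cod C t = Dom C g"
  shows "g \<in> EE C"
proof -
  obtain d where d: "d \<in> Arr C" "Dom C d = Cod C g" "Cod C d = Dom C (MPart C g)"
      "d \<cdot> (g \<cdot> t) = EPart C g \<cdot> t" "MPart C g \<cdot> d = Id C (Cod C g)"
    using diagonal_fill_in[of "g \<cdot> t" "MPart C g" "EPart C g \<cdot> t" "Id C (Cod C g)"] assms
    by auto
  have "d \<cdot> MPart C g = Id C (Dom C (MPart C g))"
    by (rule mono_cancel[OF MM_mono[OF MPart_MM[OF \<open>g \<in> Arr C\<close>]]])
      (use d assms in \<open>simp_all add: Comp_reassoc[OF d(5)]\<close>)
  then have "iso C (MPart C g)"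
    using d assms by (auto simp: iso_def Hom_iff intro!: bexI[of _ d])
  with EE_iso_left[of "EPart C g" "MPart C g"] assms show ?thesis
    by simp
qed

section \<open>The preorders of subobjects and quotients\<close>

lemma sub_iso_refl: "j \<in> Arr C \<Longrightarrow> sub_iso C j j"
  by (auto simp: sub_iso_def Hom_iff iso_Id intro!: bexI[of _ "Id C (Dom C j)"])

lemma quot_iso_refl: "x \<in> Arr C \<Longrightarrow> quot_iso C x x"
  by (auto simp: quot_iso_def Hom_iff iso_Id intro!: bexI[of _ "Id C (Cod C x)"])

lemma sub_iso_imp_le: "sub_iso C j k \<Longrightarrow> sub_le C j k"
  by (auto simp: sub_iso_def sub_le_def)

lemma quot_iso_imp_le: "quot_iso C x y \<Longrightarrow> quot_le C x y"
  by (auto simp: quot_iso_def quot_le_def)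

lemma sub_le_refl: "j \<in> Arr C \<Longrightarrow> sub_le C j j"
  by (simp add: sub_iso_imp_le sub_iso_refl)

lemma quot_le_refl: "x \<in> Arr C \<Longrightarrow> quot_le C x x"
  by (simp add: quot_iso_imp_le quot_iso_refl)

lemma sub_le_trans:
  assumes "sub_le C j k" and "sub_le C k l" and "l \<in> Arr C"
  shows "sub_le C j l"
proof -
  from assms obtain f g where f: "f \<in> Hom C (Dom C j) (Dom C k)" "j = k \<cdot> f"
      and g: "g \<in> Hom C (Dom C k) (Dom C l)" "k = l \<cdot> g"
    unfolding sub_le_def by blast
  have "j = l \<cdot> (g \<cdot> f)"
    using Comp_assoc[OF f(1) g(1) HomI[OF assms(3)]] f(2) g(2) by metis
  with Comp_Hom[OF f(1) g(1)] show ?thesis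
    unfolding sub_le_def by blast
qed

lemma quot_le_trans:
  assumes "quot_le C x y" and "quot_le C y z" and "x \<in> Arr C"
  shows "quot_le C x z"
proof -
  from assms obtain f g where f: "f \<in> Hom C (Cod C x) (Cod C y)" "y = f \<cdot> x"
      and g: "g \<in> Hom C (Cod C y) (Cod C z)" "z = g \<cdot> y"
    unfolding quot_le_def by blast
  have "z = g \<cdot> f \<cdot> x"
    using Comp_assoc[OF HomI[OF assms(3)] f(1) g(1)] f(2) g(2) by metis
  with Comp_Hom[OF f(1) g(1)] show ?thesis
    unfolding quot_le_def by blast
qed

lemma sub_iso_imp_ge:
  assumes "sub_iso C j k" and "k \<in> Arr C"
  shows "sub_le C k j"
proof -
  obtain f where f: "f \<in> Hom C (Dom C j) (Dom C k)" "iso C f" "j = k \<cdot> f"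
    using assms(1) unfolding sub_iso_def by blast
  then have "Dom C f = Dom C j" "Cod C f = Dom C k"
    by (simp_all add: Hom_iff)
  with f(2) obtain g where g: "g \<in> Hom C (Dom C k) (Dom C j)" "f \<cdot> g = Id C (Dom C k)"
    by (auto simp: iso_def)
  have "k = j \<cdot> g"
    using Comp_assoc[OF g(1) f(1) HomI[OF assms(2)]] f(3) g(2) Id_right_Arr[OF assms(2) refl] by metis
  with g(1) show ?thesis
    unfolding sub_le_def by blast
qed

text \<open>\<open>f \<cdot> g\<close> already factors through the image of \<open>f\<close>, and
  the diagonal compares this with its own factorisation.\<close>

lemma MPart_Comp_le:
  assumes "f \<in> Arr C" and "g \<in> Arr C" and "Cod C g = Dom C f"
  shows "sub_le C (MPart C (f \<cdot> g)) (MPart C f)"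
proof -
  obtain d where "d \<in> Arr C" "Dom C d = Dom C (MPart C (f \<cdot> g))" "Cod C d = Dom C (MPart C f)"
      "MPart C f \<cdot> d = MPart C (f \<cdot> g)"
    using diagonal_fill_in[of "EPart C (f \<cdot> g)" "MPart C f" "EPart C f \<cdot> g" "MPart C (f \<cdot> g)"] assms
    by auto
  then show ?thesis
    unfolding sub_le_def by (intro bexI[of _ d]) (auto simp: Hom_iff)
qed

end

section \<open>Recursive coalgebras and free algebras\<close>

context learning_category
begin

declare FObj_Obj [simp] InpObj_Obj [simp] OutObj_Obj [simp] TObj_Obj [simp] FArr_EE [simp]

lemma FArr_Arr_Dom_Cod [simp]:
  assumes "f \<in> Arr C"
  shows "FArr C f \<in> Arr C" and "Dom C (FArr C f) = FObj C (Dom C f)"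
    and "Cod C (FArr C f) = FObj C (Cod C f)"
  using FArr_Hom[OF HomI[OF assms]] by (auto simp: Hom_iff)

lemma FArr_Comp_Arr:
  "f \<in> Arr C \<Longrightarrow> g \<in> Arr C \<Longrightarrow> Dom C g = Cod C f \<Longrightarrow> FArr C (g \<cdot> f) = FArr C g \<cdot> FArr C f"
  using FArr_Comp[of f "Dom C f" "Cod C f" g "Cod C g"] by (simp add: Hom_iff)

text \<open>Rewrites the defining equation of a recursive extension into
  \<open>h = cotuple C i (d \<cdot> FArr C h) \<cdot> \<rho>\<close>, in which only \<open>F\<close>
  occurs; this is the form used from here on.\<close>

lemma cotuple_FIArr:
  assumes "i \<in> Hom C (InpObj C) Y" and "d \<in> Hom C (FObj C X) Y" and "h \<in> Hom C Z X"
  shows "cotuple C i d \<cdot> FIArr C h = cotuple C i (d \<cdot> FArr C h)"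
proof -
  have XZ: "X \<in> Obj C" "Z \<in> Obj C" "InpObj C \<in> Obj C" "FObj C X \<in> Obj C"
    using assms by (auto simp: Hom_iff)
  note p = cotuple_props[OF assms(1,2)]
  note In = In1_Hom[OF XZ(3,4)] In2_Hom[OF XZ(3,4)]
  have "cotuple C i d \<cdot> FIArr C h = cotuple C (cotuple C i d \<cdot> In1 C (InpObj C) (FObj C X))
      (cotuple C i d \<cdot> (In2 C (InpObj C) (FObj C X) \<cdot> FArr C h))"
    using assms(3) Comp_cotuple[OF In(1) Comp_Hom[OF FArr_Hom[OF assms(3)] In(2)] p(1)]
    by (simp add: FIArr_def Hom_iff)
  also have "cotuple C i d \<cdot> (In2 C (InpObj C) (FObj C X) \<cdot> FArr C h) = d \<cdot> FArr C h"
    using Comp_assoc[OF FArr_Hom[OF assms(3)] In(2) p(1)] p(3) by simp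
  finally show ?thesis
    by (simp add: p(2))
qed

lemma rec_ext_props:
  assumes "recursive C S \<rho>" and "i \<in> Hom C (InpObj C) X" and "d \<in> Hom C (FObj C X) X"
  shows "rec_ext C \<rho> (cotuple C i d) \<in> Hom C S X"
    and "rec_ext C \<rho> (cotuple C i d) = cotuple C i (d \<cdot> FArr C (rec_ext C \<rho> (cotuple C i d))) \<cdot> \<rho>"
proof -
  have X: "X \<in> Obj C"
    using assms by (auto simp: Hom_iff)
  have x: "cotuple C i d \<in> Hom C (FIObj C X) X"
    using cotuple_props(1)[OF assms(2,3)] by (simp add: FIObj_def)
  have ex1: "\<exists>!h. h \<in> Hom C S X \<and> h = cotuple C i d \<cdot> FIArr C h \<cdot> \<rho>"
    using assms(1) X x by (auto simp: recursive_def)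
  have "Dom C \<rho> = S" "Cod C (cotuple C i d) = X"
    using assms(1) x by (auto simp: recursive_def Hom_iff)
  with theI'[OF ex1] have *: "rec_ext C \<rho> (cotuple C i d) \<in> Hom C S X"
    "rec_ext C \<rho> (cotuple C i d) = cotuple C i d \<cdot> FIArr C (rec_ext C \<rho> (cotuple C i d)) \<cdot> \<rho>"
    unfolding rec_ext_def by simp_all
  from *(1) show "rec_ext C \<rho> (cotuple C i d) \<in> Hom C S X" .
  from *(2) show "rec_ext C \<rho> (cotuple C i d) =
      cotuple C i (d \<cdot> FArr C (rec_ext C \<rho> (cotuple C i d))) \<cdot> \<rho>"
    unfolding cotuple_FIArr[OF assms(2,3) *(1)] .
qed

lemma rec_ext_eqI:
  assumes "recursive C S \<rho>" and "i \<in> Hom C (InpObj C) X" and "d \<in> Hom C (FObj C X) X"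
    and "h \<in> Hom C S X" and "h = cotuple C i (d \<cdot> FArr C h) \<cdot> \<rho>"
  shows "rec_ext C \<rho> (cotuple C i d) = h"
proof -
  have X: "X \<in> Obj C"
    using assms by (auto simp: Hom_iff)
  have x: "cotuple C i d \<in> Hom C (FIObj C X) X"
    using cotuple_props(1)[OF assms(2,3)] by (simp add: FIObj_def)
  have ex1: "\<exists>!h. h \<in> Hom C S X \<and> h = cotuple C i d \<cdot> FIArr C h \<cdot> \<rho>"
    using assms(1) X x by (auto simp: recursive_def)
  note r = rec_ext_props[OF assms(1-3)]
  have "h = cotuple C i d \<cdot> FIArr C h \<cdot> \<rho>"
    unfolding cotuple_FIArr[OF assms(2,3,4)] by (rule assms(5))
  moreover have "rec_ext C \<rho> (cotuple C i d) =
      cotuple C i d \<cdot> FIArr C (rec_ext C \<rho> (cotuple C i d)) \<cdot> \<rho>"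
    unfolding cotuple_FIArr[OF assms(2,3) r(1)] by (rule r(2))
  ultimately show ?thesis
    using ex1 r(1) assms(4) by blast
qed

text \<open>Composing the equation for the extension into \<open>X\<close> with the algebra morphism
  \<open>g\<close> gives the equation for the extension into \<open>Y\<close>, whose solution is
  unique.\<close>

lemma rec_ext_algebra_hom:
  assumes "recursive C S \<rho>" and "i \<in> Hom C (InpObj C) X" and "d \<in> Hom C (FObj C X) X"
    and "d' \<in> Hom C (FObj C Y) Y" and "g \<in> Hom C X Y" and "g \<cdot> d = d' \<cdot> FArr C g"
  shows "rec_ext C \<rho> (cotuple C (g \<cdot> i) d') = g \<cdot> rec_ext C \<rho> (cotuple C i d)"
proof -
  define r where "r = rec_ext C \<rho> (cotuple C i d)"
  have r: "r \<in> Hom C S X" and req: "r = cotuple C i (d \<cdot> FArr C r) \<cdot> \<rho>"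
    unfolding r_def by (rule rec_ext_props[OF assms(1-3)])+
  have dr: "d \<cdot> FArr C r \<in> Hom C (FObj C S) X"
    using r assms by (simp add: Hom_iff)
  have \<rho>: "\<rho> \<in> Hom C S (Coprod C (InpObj C) (FObj C S))"
    using assms(1) by (simp add: recursive_def FIObj_def)
  have "g \<cdot> r = g \<cdot> (cotuple C i (d \<cdot> FArr C r) \<cdot> \<rho>)"
    using req by (rule arg_cong)
  also have "\<dots> = g \<cdot> cotuple C i (d \<cdot> FArr C r) \<cdot> \<rho>"
    by (rule Comp_assoc[OF \<rho> cotuple_props(1)[OF assms(2) dr] assms(5), symmetric])
  also have "\<dots> = cotuple C (g \<cdot> i) (g \<cdot> (d \<cdot> FArr C r)) \<cdot> \<rho>"
    by (simp add: Comp_cotuple[OF assms(2) dr assms(5)])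
  also have "g \<cdot> (d \<cdot> FArr C r) = d' \<cdot> FArr C (g \<cdot> r)"
    using assms r by (simp add: Comp_reassoc[OF assms(6)] Hom_iff FArr_Comp_Arr)
  finally show ?thesis
    unfolding r_def[symmetric]
    by (rule rec_ext_eqI[OF assms(1) Comp_Hom[OF assms(2,5)] assms(4) Comp_Hom[OF r assms(5)]])
qed

section \<open>Free algebras and the recursive coalgebra on \<open>TI\<close>\<close>

lemma sharp_props:
  assumes "f \<in> Hom C X Y" and "y \<in> Hom C (FObj C Y) Y"
  shows "sharp C y f \<in> Hom C (TObj C X) Y"
    and "sharp C y f \<cdot> gamma C X = y \<cdot> FArr C (sharp C y f)"
    and "sharp C y f \<cdot> eta C X = f"
proof -
  have X: "X \<in> Obj C" "Y \<in> Obj C"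
    using assms by (auto simp: Hom_iff)
  from theI'[OF free_universal[OF X assms(2,1)]] assms(1)
  show "sharp C y f \<in> Hom C (TObj C X) Y"
    "sharp C y f \<cdot> gamma C X = y \<cdot> FArr C (sharp C y f)" "sharp C y f \<cdot> eta C X = f"
    by (auto simp: sharp_def Hom_iff)
qed

lemma sharp_eqI:
  assumes "X \<in> Obj C" and "y \<in> Hom C (FObj C Y) Y" and "g \<in> Hom C (TObj C X) Y"
    and "g \<cdot> gamma C X = y \<cdot> FArr C g" and "g \<cdot> eta C X = f"
  shows "sharp C y f = g"
proof -
  have f: "f \<in> Hom C X Y"
    using assms eta_Hom[OF assms(1)] Comp_Hom by blast
  then have "Y \<in> Obj C"
    by (auto simp: Hom_iff)
  from free_universal[OF assms(1) this assms(2) f] sharp_props[OF f assms(2)] assms show ?thesis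
    by blast
qed

lemma sharp_algebra_hom:
  assumes "f \<in> Hom C X Y" and "y \<in> Hom C (FObj C Y) Y" and "z \<in> Hom C (FObj C Z) Z"
    and "h \<in> Hom C Y Z" and "h \<cdot> y = z \<cdot> FArr C h"
  shows "sharp C z (h \<cdot> f) = h \<cdot> sharp C y f"
proof -
  note s = sharp_props[OF assms(1,2)]
  have X: "X \<in> Obj C"
    using assms(1) by (auto simp: Hom_iff)
  note ge = gamma_Hom[OF X] eta_Hom[OF X]
  have "h \<cdot> sharp C y f \<cdot> gamma C X = h \<cdot> (y \<cdot> FArr C (sharp C y f))"
    using Comp_assoc[OF ge(1) s(1) assms(4)] s(2) by simp
  also have "\<dots> = z \<cdot> FArr C (h \<cdot> sharp C y f)"
    using assms s(1) by (simp add: Comp_reassoc[OF assms(5)] Hom_iff FArr_Comp_Arr)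
  finally show ?thesis
    using Comp_assoc[OF ge(2) s(1) assms(4)] s(3)
    by (intro sharp_eqI[OF X assms(3) Comp_Hom[OF s(1) assms(4)]]) simp_all
qed

text \<open>By Lambek's lemma the initial \<open>F\<^sub>I\<close>-algebra \<open>TI\<close> is an isomorphism; its inverse is recursive.\<close>

lemma recursive_TObj:
  "\<exists>\<tau>. recursive C (TObj C (InpObj C)) \<tau> \<and>
    (\<forall>X. \<forall>i \<in> Hom C (InpObj C) X. \<forall>d \<in> Hom C (FObj C X) X.
      rec_ext C \<tau> (cotuple C i d) = sharp C d i)"
proof -
  define I T where "I = InpObj C" and "T = TObj C I"
  have I: "I \<in> Obj C" and T: "T \<in> Obj C" and FT: "FObj C T \<in> Obj C"
    by (auto simp: I_def T_def)
  define J where "J = Coprod C I (FObj C T)"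
  note ge = eta_Hom[OF I, folded T_def] gamma_Hom[OF I, folded T_def]
  note In = In1_Hom[OF I FT, folded J_def] In2_Hom[OF I FT, folded J_def]
  \<comment> \<open>\<open>a\<close> is the structure of \<open>T\<close> as an algebra for
    \<open>I + F(-)\<close>, and \<open>J\<close> is that functor applied to
    \<open>T\<close>.\<close>
  define a where "a = cotuple C (eta C I) (gamma C I)"
  have a: "a \<in> Hom C J T" "a \<cdot> In1 C I (FObj C T) = eta C I" "a \<cdot> In2 C I (FObj C T) = gamma C I"
    unfolding a_def J_def using cotuple_props[OF ge] by simp_all
  \<comment> \<open>As in Lambek's argument, \<open>J\<close> becomes an algebra through the functor
    applied to \<open>a\<close>: \<open>y\<close> is its part on \<open>FJ\<close>, and the
    injection of \<open>I\<close> is its part on \<open>I\<close>. The induced map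
    \<open>\<tau>\<close> out of the free algebra is the candidate inverse of
    \<open>a\<close>.\<close>
  define y where "y = In2 C I (FObj C T) \<cdot> FArr C a"
  have y: "y \<in> Hom C (FObj C J) J"
    unfolding y_def using Comp_Hom[OF FArr_Hom[OF a(1)] In(2)] .
  define \<tau> where "\<tau> = sharp C y (In1 C I (FObj C T))"
  note \<tau> = sharp_props[OF In(1) y, folded T_def \<tau>_def]
  have Id_T: "sharp C (gamma C I) (eta C I) = Id C T"
    by (rule sharp_eqI[OF I ge(2)]) (use ge T in \<open>auto simp: Hom_iff T_def[symmetric] FArr_Id\<close>)
  have ay: "a \<cdot> y = gamma C I \<cdot> FArr C a"
    unfolding y_def using a In by (simp add: Comp_reassoc[OF a(3)] Hom_iff)
  have a\<tau>: "a \<cdot> \<tau> = Id C T"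
    using sharp_algebra_hom[OF In(1) y ge(2) a(1) ay] Id_T by (simp add: \<tau>_def a(2))
  have "y \<cdot> FArr C \<tau> = In2 C I (FObj C T)"
    unfolding y_def using a(1) In \<tau>(1) T
    by (simp add: Hom_iff FArr_Comp_Arr[symmetric] a\<tau> FArr_Id)
  with \<tau>(2) have \<tau>\<gamma>: "\<tau> \<cdot> gamma C I = In2 C I (FObj C T)"
    by (rule trans)
  have J: "J \<in> Obj C"
    unfolding J_def by (rule Coprod_Obj[OF I FT])
  have "cotuple C (In1 C I (FObj C T)) (In2 C I (FObj C T)) = Id C J"
    by (rule cotuple_eqI[OF Id_Hom[OF J, unfolded J_def], folded J_def, OF _ _ I FT])
      (use In in \<open>simp_all add: Hom_iff\<close>)
  then have \<tau>a: "\<tau> \<cdot> a = Id C J"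
    unfolding a_def Comp_cotuple[OF ge \<tau>(1)] \<tau>\<gamma> \<tau>(3) .
  \<comment> \<open>Since \<open>\<tau>\<close> is inverse to \<open>a\<close>, the recursion
    equation can be composed with \<open>a\<close> and compared on both summands; its solutions are
    then exactly the algebra morphisms extending \<open>i\<close>.\<close>
  have key: "h = cotuple C i (d \<cdot> FArr C h) \<cdot> \<tau> \<longleftrightarrow>
      h \<cdot> gamma C I = d \<cdot> FArr C h \<and> h \<cdot> eta C I = i"
    if i: "i \<in> Hom C I X" and d: "d \<in> Hom C (FObj C X) X" and h: "h \<in> Hom C T X" for h i d X
  proof -
    have dh: "d \<cdot> FArr C h \<in> Hom C (FObj C T) X"
      using Comp_Hom[OF FArr_Hom[OF h] d] .
    note c = cotuple_props[OF i dh, folded J_def]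
    have "h = cotuple C i (d \<cdot> FArr C h) \<cdot> \<tau> \<longleftrightarrow> h \<cdot> a = cotuple C i (d \<cdot> FArr C h)"
    proof
      assume "h = cotuple C i (d \<cdot> FArr C h) \<cdot> \<tau>"
      then have "h \<cdot> a = cotuple C i (d \<cdot> FArr C h) \<cdot> (\<tau> \<cdot> a)"
        using Comp_assoc[OF a(1) \<tau>(1) c(1)] by simp
      then show "h \<cdot> a = cotuple C i (d \<cdot> FArr C h)"
        unfolding \<tau>a using Id_right[OF c(1)] by simp
    next
      assume "h \<cdot> a = cotuple C i (d \<cdot> FArr C h)"
      then have "cotuple C i (d \<cdot> FArr C h) \<cdot> \<tau> = h \<cdot> (a \<cdot> \<tau>)"
        using Comp_assoc[OF \<tau>(1) a(1) h] by simp
      then show "h = cotuple C i (d \<cdot> FArr C h) \<cdot> \<tau>"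
        unfolding a\<tau> using Id_right[OF h] by simp
    qed
    also have "h \<cdot> a = cotuple C (h \<cdot> eta C I) (h \<cdot> gamma C I)"
      unfolding a_def by (rule Comp_cotuple[OF ge h])
    also have "cotuple C (h \<cdot> eta C I) (h \<cdot> gamma C I) = cotuple C i (d \<cdot> FArr C h) \<longleftrightarrow>
        h \<cdot> gamma C I = d \<cdot> FArr C h \<and> h \<cdot> eta C I = i"
      using cotuple_props[OF Comp_Hom[OF ge(1) h] Comp_Hom[OF ge(2) h]] c(2,3) by auto
    finally show ?thesis .
  qed
  have "recursive C T \<tau>"
    unfolding recursive_def
  proof (intro conjI ballI)
    show "\<tau> \<in> Hom C T (FIObj C T)"
      using \<tau>(1) by (simp add: FIObj_def J_def I_def)
    fix X x
    assume X: "X \<in> Obj C" and x: "x \<in> Hom C (FIObj C X) X"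
    have FX: "FObj C X \<in> Obj C"
      using X by simp
    \<comment> \<open>An arbitrary algebra \<open>x\<close> for \<open>I + F(-)\<close> is split
      into its two components, so that freeness of \<open>T\<close> applies.\<close>
    define i d where "i = x \<cdot> In1 C I (FObj C X)" and "d = x \<cdot> In2 C I (FObj C X)"
    have i: "i \<in> Hom C I X" and d: "d \<in> Hom C (FObj C X) X"
      unfolding i_def d_def
      using x In1_Hom[OF I FX] In2_Hom[OF I FX] by (auto simp: FIObj_def I_def intro: Comp_Hom)
    have "cotuple C i d = x"
      using x I FX by (intro cotuple_eqI[where X = I and Y = "FObj C X"]) (auto simp: FIObj_def I_def i_def d_def)
    then have "x \<cdot> FIArr C h = cotuple C i (d \<cdot> FArr C h)" if "h \<in> Hom C T X" for h
      using cotuple_FIArr[OF i[unfolded I_def] d that] by simp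
    then have "h \<in> Hom C T X \<and> h = x \<cdot> FIArr C h \<cdot> \<tau> \<longleftrightarrow>
        h \<in> Hom C T X \<and> h \<cdot> gamma C I = d \<cdot> FArr C h \<and> h \<cdot> eta C I = i" for h
      using key[OF i d] by auto
    then show "\<exists>!h. h \<in> Hom C T X \<and> h = x \<cdot> FIArr C h \<cdot> \<tau>"
      using free_universal[OF I X d i] by (simp add: T_def)
  qed (rule T)
  moreover have "rec_ext C \<tau> (cotuple C i d) = sharp C d i"
    if "i \<in> Hom C (InpObj C) X" "d \<in> Hom C (FObj C X) X" for i d X
    using sharp_props[OF that] key[of i X d "sharp C d i"] that
    by (intro rec_ext_eqI[OF calculation that]) (auto simp: I_def T_def)
  ultimately show ?thesis
    by (auto simp: T_def I_def)
qed

text \<open>\<open>sharp C d i\<close> is an algebra morphism out of \<open>TI\<close>, so every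
  recursive extension passes through the one into the free algebra. This links
  \<open>\<rho>\<close>-languages to languages and, later, recursive coalgebras to
  reachability.\<close>

lemma rec_ext_eq_sharp_Comp:
  assumes "recursive C S \<rho>" and "i \<in> Hom C (InpObj C) X" and "d \<in> Hom C (FObj C X) X"
  shows "rec_ext C \<rho> (cotuple C i d) =
    sharp C d i \<cdot> rec_ext C \<rho> (cotuple C (eta C (InpObj C)) (gamma C (InpObj C)))"
  using rec_ext_algebra_hom[OF assms(1) eta_Hom gamma_Hom assms(3) sharp_props(1,2)[OF assms(2,3)]]
    sharp_props(3)[OF assms(2,3)] by simp

section \<open>Automata and wrappers\<close>

lemma rec_language_eq_language_Comp:
  assumes "automaton C A" and "recursive C S \<rho>"
  shows "rec_language C \<rho> A =
    language C A \<cdot> rec_ext C \<rho> (cotuple C (eta C (InpObj C)) (gamma C (InpObj C)))"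
proof -
  have A: "init A \<in> Hom C (InpObj C) (State A)" "delta A \<in> Hom C (FObj C (State A)) (State A)"
    "out A \<in> Hom C (State A) (OutObj C)"
    using assms(1) by (auto simp: automaton_def)
  show ?thesis
    unfolding rec_language_def language_def rec_ext_eq_sharp_Comp[OF assms(2) A(1,2)]
    using Comp_assoc[OF rec_ext_props(1)[OF assms(2) eta_Hom gamma_Hom] sharp_props(1)[OF A(1,2)] A(3)]
    by simp
qed

text \<open>The language determines every \<open>\<rho>\<close>-language by precomposition, and it
  is itself the \<open>\<tau>\<close>-language for the recursive coalgebra on
  \<open>TI\<close>.\<close>

lemma language_eq_iff_rec_language_eq:
  assumes "automaton C A" and "automaton C B"
  shows "language C A = language C B \<longleftrightarrow>
    (\<forall>S \<rho>. recursive C S \<rho> \<longrightarrow> rec_language C \<rho> A = rec_language C \<rho> B)"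
proof
  assume "language C A = language C B"
  then show "\<forall>S \<rho>. recursive C S \<rho> \<longrightarrow> rec_language C \<rho> A = rec_language C \<rho> B"
    using rec_language_eq_language_Comp assms by metis
next
  assume *: "\<forall>S \<rho>. recursive C S \<rho> \<longrightarrow> rec_language C \<rho> A = rec_language C \<rho> B"
  obtain \<tau> where \<tau>: "recursive C (TObj C (InpObj C)) \<tau>"
    "\<forall>X. \<forall>i \<in> Hom C (InpObj C) X. \<forall>d \<in> Hom C (FObj C X) X.
      rec_ext C \<tau> (cotuple C i d) = sharp C d i"
    using recursive_TObj by blast
  have "rec_language C \<tau> D = language C D" if "automaton C D" for D
    unfolding rec_language_def language_def
    using \<tau>(2) that unfolding automaton_def by metis
  with * \<tau>(1) assms show "language C A = language C B"
    by metis
qed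

section \<open>Closed and consistent wrappers and their hypotheses\<close>

lemma wrapper_Arr_Dom_Cod:
  assumes "wrapper C Q W"
  shows "fst W \<in> Arr C" "Cod C (fst W) = Q" "snd W \<in> Arr C" "Dom C (snd W) = Q"
    "e_wrap C W \<in> EE C" "m_wrap C W \<in> MM C" "Dom C (e_wrap C W) = Dom C (fst W)"
    "Cod C (e_wrap C W) = H_wrap C W" "Dom C (m_wrap C W) = H_wrap C W"
    "Cod C (m_wrap C W) = Cod C (snd W)" "m_wrap C W \<cdot> e_wrap C W = snd W \<cdot> fst W"
  using assms by (auto simp: wrapper_def e_wrap_def m_wrap_def H_wrap_def)

lemma automaton_Arr_Dom_Cod:
  assumes "automaton C A"
  shows "State A \<in> Obj C" "delta A \<in> Arr C" "Dom C (delta A) = FObj C (State A)"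
    "Cod C (delta A) = State A" "init A \<in> Arr C" "Dom C (init A) = InpObj C"
    "Cod C (init A) = State A" "out A \<in> Arr C" "Dom C (out A) = State A"
    "Cod C (out A) = OutObj C"
  using assms by (auto simp: automaton_def Hom_iff)

text \<open>The descriptions in \<open>hypothesis\<close> denote: the mediating morphisms are unique
  because \<open>m_wrap C W\<close> is mono and both \<open>e_wrap C W\<close> and its image under
  \<open>F\<close> are epi. The last equation is the form of the transition structure used in later
  arguments.\<close>

lemma hypothesis_props:
  assumes A: "automaton C A" and W: "closed C A W" "consistent C A W"
  shows "automaton C (hypothesis C A W)" and "State (hypothesis C A W) = H_wrap C W"
    and "m_wrap C W \<cdot> init (hypothesis C A W) = snd W \<cdot> init A"
    and "out (hypothesis C A W) \<cdot> e_wrap C W = out A \<cdot> fst W"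
    and "m_wrap C W \<cdot> (delta (hypothesis C A W) \<cdot> FArr C (e_wrap C W)) =
      snd W \<cdot> (delta A \<cdot> FArr C (fst W))"
proof -
  have wr: "wrapper C (State A) W"
    using W by (simp add: closed_def)
  note w = wrapper_Arr_Dom_Cod[OF wr] and a = automaton_Arr_Dom_Cod[OF A]
  note m_cancel = mono_cancel[OF MM_mono[OF w(6)]] and e_cancel = epi_cancel[OF EE_epi[OF w(5)]]
    and Fe_cancel = epi_cancel[OF EE_epi[OF FArr_EE[OF w(5)]]]
  obtain i c o' k where i: "is_init_wrap C A W i" and c: "is_close C A W (fst W) c"
    and o': "is_out_wrap C A W o'" and k: "is_cons C A W (snd W) k"
    using W by (auto simp: closed_def consistent_def)
  have i_eq: "(THE k. is_init_wrap C A W k) = i"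
    using i by (intro the_equality) (auto simp: is_init_wrap_def Hom_iff w intro: m_cancel)
  have c_eq: "(THE k. is_close C A W (fst W) k) = c"
    using c by (intro the_equality) (auto simp: is_close_def Hom_iff w intro: m_cancel)
  have o_eq: "(THE k. is_out_wrap C A W k) = o'"
    using o' by (intro the_equality) (auto simp: is_out_wrap_def Hom_iff w intro: e_cancel)
  have k_eq: "(THE k. is_cons C A W (snd W) k) = k"
    using k by (intro the_equality) (auto simp: is_cons_def Hom_iff w intro: Fe_cancel)
  \<comment> \<open>The square commutes because both composites equal
    \<open>\<beta> \<cdot> \<delta> \<cdot> F\<alpha>\<close>; its left side lies in
    \<open>EE C\<close> because \<open>F\<close> preserves that class.\<close>
  have "\<exists>!d. d \<in> Hom C (Cod C (FArr C (e_wrap C W))) (Dom C (m_wrap C W)) \<and>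
      d \<cdot> FArr C (e_wrap C W) = c \<and> m_wrap C W \<cdot> d = k"
    by (rule diagonal) (use c k w in \<open>auto simp: is_close_def is_cons_def Hom_iff\<close>)
  then have ex1: "\<exists>!d. d \<in> Hom C (FObj C (H_wrap C W)) (H_wrap C W) \<and>
      d \<cdot> FArr C (e_wrap C W) = c \<and> m_wrap C W \<cdot> d = k"
    using w by simp
  have H: "State (hypothesis C A W) = H_wrap C W" "init (hypothesis C A W) = i"
    "out (hypothesis C A W) = o'"
    by (simp_all add: hypothesis_def i_eq o_eq)
  define d where "d = delta (hypothesis C A W)"
  have d: "d \<in> Hom C (FObj C (H_wrap C W)) (H_wrap C W)" "d \<cdot> FArr C (e_wrap C W) = c"
    using theI'[OF ex1] by (simp_all add: d_def hypothesis_def c_eq k_eq)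
  show "automaton C (hypothesis C A W)"
    using d i o' w Cod_Obj[of "e_wrap C W"]
    by (auto simp: automaton_def d_def H is_init_wrap_def is_out_wrap_def)
  show "State (hypothesis C A W) = H_wrap C W"
    by (rule H)
  show "m_wrap C W \<cdot> init (hypothesis C A W) = snd W \<cdot> init A"
    using i by (simp add: H is_init_wrap_def)
  show "out (hypothesis C A W) \<cdot> e_wrap C W = out A \<cdot> fst W"
    using o' by (simp add: H is_out_wrap_def)
  show "m_wrap C W \<cdot> (delta (hypothesis C A W) \<cdot> FArr C (e_wrap C W)) =
      snd W \<cdot> (delta A \<cdot> FArr C (fst W))"
    using c d(2) w a by (simp add: d_def[symmetric] is_close_def Hom_iff)
qed

lemma correct_hypothesis_iff:
  assumes "automaton C A"
  shows "correct_hypothesis C A W \<longleftrightarrow>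
    closed C A W \<and> consistent C A W \<and> correct_up_to_all C A W"
  using language_eq_iff_rec_language_eq[OF hypothesis_props(1)[OF assms, of W] assms]
  by (auto simp: correct_hypothesis_def correct_up_to_all_def correct_up_to_def)

text \<open>As \<open>m_wrap C W\<close> is mono, the recursion equation for \<open>x\<close> in the
  hypothesis can be checked after composing with it. There it becomes \<open>snd W\<close> composed
  with the equation for \<open>r\<close> in the target, by \<open>mx\<close> on the left and
  \<open>step\<close> on the right.\<close>

lemma rec_ext_hypothesis_eqI:
  assumes A: "automaton C A" and W: "closed C A W" "consistent C A W" and \<rho>: "recursive C S \<rho>"
    and r_def: "r = rec_ext C \<rho> (cotuple C (init A) (delta A))"
    and x: "x \<in> Hom C S (H_wrap C W)" and mx: "m_wrap C W \<cdot> x = snd W \<cdot> r"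
    and step: "m_wrap C W \<cdot> (delta (hypothesis C A W) \<cdot> FArr C x) = snd W \<cdot> (delta A \<cdot> FArr C r)"
  shows "rec_ext C \<rho> (cotuple C (init (hypothesis C A W)) (delta (hypothesis C A W))) = x"
proof -
  let ?H = "hypothesis C A W"
  note h = hypothesis_props[OF A W]
  have wr: "wrapper C (State A) W"
    using W by (simp add: closed_def)
  note w = wrapper_Arr_Dom_Cod[OF wr] and a = automaton_Arr_Dom_Cod[OF A]
    and ha = automaton_Arr_Dom_Cod[OF h(1), unfolded h(2)]
  have iA: "init A \<in> Hom C (InpObj C) (State A)" and dA: "delta A \<in> Hom C (FObj C (State A)) (State A)"
    using A by (auto simp: automaton_def)
  have iH: "init ?H \<in> Hom C (InpObj C) (H_wrap C W)"
    and dH: "delta ?H \<in> Hom C (FObj C (H_wrap C W)) (H_wrap C W)"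
    using ha by (auto simp: Hom_iff)
  have r: "r \<in> Hom C S (State A)" and req: "r = cotuple C (init A) (delta A \<cdot> FArr C r) \<cdot> \<rho>"
    unfolding r_def by (rule rec_ext_props[OF \<rho> iA dA])+
  have m: "m_wrap C W \<in> Hom C (H_wrap C W) (Cod C (snd W))"
    and s: "snd W \<in> Hom C (State A) (Cod C (snd W))"
    using w by (auto simp: Hom_iff)
  have \<rho>_Hom: "\<rho> \<in> Hom C S (Coprod C (InpObj C) (FObj C S))"
    using \<rho> by (simp add: recursive_def FIObj_def)
  have dr: "delta A \<cdot> FArr C r \<in> Hom C (FObj C S) (State A)"
    and dx: "delta ?H \<cdot> FArr C x \<in> Hom C (FObj C S) (H_wrap C W)"
    using Comp_Hom[OF FArr_Hom[OF r] dA] Comp_Hom[OF FArr_Hom[OF x] dH] .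
  note cr = cotuple_props(1)[OF iA dr] and cx = cotuple_props(1)[OF iH dx]
  have "m_wrap C W \<cdot> x = snd W \<cdot> (cotuple C (init A) (delta A \<cdot> FArr C r) \<cdot> \<rho>)"
    unfolding mx using req by (rule arg_cong)
  also have "\<dots> = snd W \<cdot> cotuple C (init A) (delta A \<cdot> FArr C r) \<cdot> \<rho>"
    by (rule Comp_assoc[OF \<rho>_Hom cr s, symmetric])
  also have "\<dots> = m_wrap C W \<cdot> cotuple C (init ?H) (delta ?H \<cdot> FArr C x) \<cdot> \<rho>"
    by (simp add: Comp_cotuple[OF iA dr s] Comp_cotuple[OF iH dx m] h(3) step)
  also have "\<dots> = m_wrap C W \<cdot> (cotuple C (init ?H) (delta ?H \<cdot> FArr C x) \<cdot> \<rho>)"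
    by (rule Comp_assoc[OF \<rho>_Hom cx m])
  finally have "x = cotuple C (init ?H) (delta ?H \<cdot> FArr C x) \<cdot> \<rho>"
    using x w Comp_Hom[OF \<rho>_Hom cx]
    by (elim mono_cancel[OF MM_mono[OF w(6)]]) (auto simp: Hom_iff)
  then show ?thesis
    by (rule rec_ext_eqI[OF \<rho> iH dH x])
qed

section \<open>Progress of a run\<close>

text \<open>The diagonal between two factorisations of \<open>\<beta> \<cdot> \<alpha>\<close>, one
  of them passing through the image of \<open>\<alpha>\<close>. It exhibits
  \<open>H_wrap C W\<close> as the image of the subobject under \<open>\<beta>\<close>.\<close>

lemma wrapper_image_through_MPart:
  assumes "wrapper C Q W"
  obtains d where "d \<in> Arr C" and "Dom C d = Dom C (MPart C (fst W))" and "Cod C d = H_wrap C W"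
    and "d \<cdot> EPart C (fst W) = e_wrap C W" and "m_wrap C W \<cdot> d = snd W \<cdot> MPart C (fst W)"
  using diagonal_fill_in[of "EPart C (fst W)" "m_wrap C W" "e_wrap C W" "snd W \<cdot> MPart C (fst W)"]
    wrapper_Arr_Dom_Cod[OF assms] by simp blast

lemma wrapper_image_through_EPart:
  assumes "wrapper C Q W"
  obtains d where "d \<in> Arr C" and "Dom C d = H_wrap C W" and "Cod C d = Cod C (EPart C (snd W))"
    and "d \<cdot> e_wrap C W = EPart C (snd W) \<cdot> fst W" and "MPart C (snd W) \<cdot> d = m_wrap C W"
  using diagonal_fill_in[of "e_wrap C W" "MPart C (snd W)" "EPart C (snd W) \<cdot> fst W" "m_wrap C W"]
    wrapper_Arr_Dom_Cod[OF assms] by simp blast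

text \<open>If \<alpha>' lies below \<alpha> as a subobject, a diagonal gives \<open>v\<close> from
  the image of \<beta>\<alpha>' to that of \<beta>\<alpha>, over their inclusions. Composing the
  mediating morphisms with \<open>v\<close> closes the original wrapper. Hence repairing a
  closedness defect must enlarge the subobject.\<close>

lemma locally_closed_imp_closed:
  assumes A: "automaton C A" and W: "wrapper C (State A) (\<alpha>, \<beta>)"
    and lc: "locally_closed C A (\<alpha>', \<beta>) \<alpha>" and le: "sub_le C (MPart C \<alpha>') (MPart C \<alpha>)"
  shows "closed C A (\<alpha>, \<beta>)"
proof -
  let ?W = "(\<alpha>, \<beta>)" and ?W' = "(\<alpha>', \<beta>)"
  have W': "wrapper C (State A) ?W'"
    using lc by (simp add: locally_closed_def)
  note w = wrapper_Arr_Dom_Cod[OF W, simplified] and w' = wrapper_Arr_Dom_Cod[OF W', simplified]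
    and a = automaton_Arr_Dom_Cod[OF A]
  obtain i c where i: "is_init_wrap C A ?W' i" and c: "is_close C A ?W' \<alpha> c"
    using lc by (auto simp: locally_closed_def)
  obtain f where f: "f \<in> Arr C" "Dom C f = Dom C (MPart C \<alpha>')" "Cod C f = Dom C (MPart C \<alpha>)"
    "MPart C \<alpha>' = MPart C \<alpha> \<cdot> f"
    using le by (auto simp: sub_le_def Hom_iff)
  obtain d where d: "d \<in> Arr C" "Dom C d = Dom C (MPart C \<alpha>)" "Cod C d = H_wrap C ?W"
    "m_wrap C ?W \<cdot> d = \<beta> \<cdot> MPart C \<alpha>"
    using wrapper_image_through_MPart[OF W] by auto
  have "m_wrap C ?W \<cdot> (d \<cdot> (f \<cdot> EPart C \<alpha>')) = \<beta> \<cdot> (MPart C \<alpha> \<cdot> (f \<cdot> EPart C \<alpha>'))"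
    using d f(1-3) w w' by (simp add: Comp_reassoc[OF d(4)])
  also have "MPart C \<alpha> \<cdot> (f \<cdot> EPart C \<alpha>') = \<alpha>'"
    using f(1-3) w w' by (simp add: Comp_reassoc[OF f(4)[symmetric]])
  finally have "m_wrap C ?W \<cdot> (d \<cdot> (f \<cdot> EPart C \<alpha>')) = m_wrap C ?W' \<cdot> e_wrap C ?W'"
    using w' by simp
  then obtain v where v: "v \<in> Arr C" "Dom C v = H_wrap C ?W'" "Cod C v = H_wrap C ?W"
    "m_wrap C ?W \<cdot> v = m_wrap C ?W'"
    using diagonal_fill_in[of "e_wrap C ?W'" "m_wrap C ?W" "d \<cdot> (f \<cdot> EPart C \<alpha>')" "m_wrap C ?W'"]
      w w' d(1-3) f(1-3) by auto
  have "is_init_wrap C A ?W (v \<cdot> i)"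
    using i v w w' a by (auto simp: is_init_wrap_def Hom_iff Comp_reassoc[OF v(4)])
  moreover have "is_close C A ?W \<alpha> (v \<cdot> c)"
    using c v w w' a by (auto simp: is_close_def Hom_iff Comp_reassoc[OF v(4)])
  ultimately show ?thesis
    using W by (auto simp: closed_def)
qed

text \<open>Dual argument: the comparison \<open>v\<close> now goes from the image of
  \<beta>\<alpha> to that of \<beta>'\<alpha> and commutes with the maps out of the domain of
  \<alpha>; the mediating morphisms are precomposed with \<open>v\<close> and
  \<open>FArr C v\<close>.\<close>

lemma locally_consistent_imp_consistent:
  assumes A: "automaton C A" and W: "wrapper C (State A) (\<alpha>, \<beta>)"
    and lc: "locally_consistent C A (\<alpha>, \<beta>') \<beta>" and le: "quot_le C (EPart C \<beta>) (EPart C \<beta>')"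
  shows "consistent C A (\<alpha>, \<beta>)"
proof -
  let ?W = "(\<alpha>, \<beta>)" and ?W' = "(\<alpha>, \<beta>')"
  have W': "wrapper C (State A) ?W'"
    using lc by (simp add: locally_consistent_def)
  note w = wrapper_Arr_Dom_Cod[OF W, simplified] and w' = wrapper_Arr_Dom_Cod[OF W', simplified]
    and a = automaton_Arr_Dom_Cod[OF A]
  obtain i c where i: "is_out_wrap C A ?W' i" and c: "is_cons C A ?W' \<beta> c"
    using lc by (auto simp: locally_consistent_def)
  obtain g where g_Hom: "g \<in> Hom C (Cod C (EPart C \<beta>)) (Cod C (EPart C \<beta>'))"
    and g_eq: "EPart C \<beta>' = g \<cdot> EPart C \<beta>"
    using le unfolding quot_le_def by blast
  have g: "g \<in> Arr C" "Dom C g = Cod C (EPart C \<beta>)" "Cod C g = Dom C (MPart C \<beta>')"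
    using g_Hom w' by (simp_all add: Hom_iff)
  obtain d where d: "d \<in> Arr C" "Dom C d = H_wrap C ?W" "Cod C d = Cod C (EPart C \<beta>)"
    "d \<cdot> e_wrap C ?W = EPart C \<beta> \<cdot> \<alpha>"
    using wrapper_image_through_EPart[OF W] by auto
  have "g \<cdot> (EPart C \<beta> \<cdot> \<alpha>) = EPart C \<beta>' \<cdot> \<alpha>"
    using g w by (simp add: Comp_reassoc[OF g_eq[symmetric]])
  then have "m_wrap C ?W' \<cdot> e_wrap C ?W' = MPart C \<beta>' \<cdot> (g \<cdot> d) \<cdot> e_wrap C ?W"
    using d g w w' by simp
  then obtain v where v: "v \<in> Arr C" "Dom C v = H_wrap C ?W" "Cod C v = H_wrap C ?W'"
    "v \<cdot> e_wrap C ?W = e_wrap C ?W'"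
    using diagonal_fill_in[of "e_wrap C ?W" "m_wrap C ?W'" "e_wrap C ?W'" "MPart C \<beta>' \<cdot> (g \<cdot> d)"]
      w w' d(1-3) g by auto
  have Fv: "FArr C v \<cdot> FArr C (e_wrap C ?W) = FArr C (e_wrap C ?W')"
    using v w by (simp add: FArr_Comp_Arr[symmetric])
  have "is_out_wrap C A ?W (i \<cdot> v)"
    using i v w w' a by (auto simp: is_out_wrap_def Hom_iff)
  moreover have "is_cons C A ?W \<beta> (c \<cdot> FArr C v)"
    using c v w w' a Fv by (auto simp: is_cons_def Hom_iff)
  ultimately show ?thesis
    using W by (auto simp: consistent_def)
qed

text \<open>The map \<open>d\<close> from the image of \<alpha> onto the hypothesis respects outputs
  and, after \<open>m_wrap C W\<close>, transitions. So \<open>d \<cdot> r'\<close> is the extension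
  of \<rho> into the hypothesis and yields the same outputs as the target.\<close>

lemma correct_up_to_if_factors:
  assumes A: "automaton C A" and W: "closed C A W" "consistent C A W" and \<rho>: "recursive C S \<rho>"
    and r': "r' \<in> Hom C S (Dom C (MPart C (fst W)))"
      "rec_ext C \<rho> (cotuple C (init A) (delta A)) = MPart C (fst W) \<cdot> r'"
  shows "correct_up_to C A W \<rho>"
proof -
  let ?H = "hypothesis C A W" and ?\<alpha> = "fst W"
  note h = hypothesis_props[OF A W]
  have wr: "wrapper C (State A) W"
    using W by (simp add: closed_def)
  note w = wrapper_Arr_Dom_Cod[OF wr] and a = automaton_Arr_Dom_Cod[OF A]
    and ha = automaton_Arr_Dom_Cod[OF h(1), unfolded h(2)]
  obtain d where d: "d \<in> Arr C" "Dom C d = Dom C (MPart C ?\<alpha>)" "Cod C d = H_wrap C W"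
    "d \<cdot> EPart C ?\<alpha> = e_wrap C W" "m_wrap C W \<cdot> d = snd W \<cdot> MPart C ?\<alpha>"
    using wrapper_image_through_MPart[OF wr] by auto
  have r'_props: "r' \<in> Arr C" "Dom C r' = S" "Cod C r' = Dom C (MPart C ?\<alpha>)"
    using r' by (auto simp: Hom_iff)
  have F: "FArr C d \<cdot> FArr C (EPart C ?\<alpha>) = FArr C (e_wrap C W)"
    "FArr C (MPart C ?\<alpha>) \<cdot> FArr C (EPart C ?\<alpha>) = FArr C ?\<alpha>"
    using d w by (simp_all add: FArr_Comp_Arr[symmetric])
  \<comment> \<open>The hypothesis is only known to simulate the target along \<alpha>; cancelling
    \<open>F\<close> of the epi part of \<alpha> moves this to the whole subobject.\<close>
  have "m_wrap C W \<cdot> (delta ?H \<cdot> FArr C d) = snd W \<cdot> (delta A \<cdot> FArr C (MPart C ?\<alpha>))"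
    by (rule epi_cancel[OF EE_epi[OF FArr_EE[OF EPart_EE[OF w(1)]]]])
      (use d w a ha h(5) F in simp_all)
  then have step: "m_wrap C W \<cdot> (delta ?H \<cdot> FArr C (d \<cdot> r')) =
      snd W \<cdot> (delta A \<cdot> FArr C (MPart C ?\<alpha> \<cdot> r'))"
    using d w a ha r'_props
      Comp_reassoc[of "m_wrap C W" "delta ?H \<cdot> FArr C d"
        "snd W \<cdot> (delta A \<cdot> FArr C (MPart C ?\<alpha>))" "FArr C r'"]
    by (simp add: FArr_Comp_Arr)
  have "rec_ext C \<rho> (cotuple C (init ?H) (delta ?H)) = d \<cdot> r'"
    using d w r'_props step
    by (intro rec_ext_hypothesis_eqI[OF A W \<rho> r'(2)[symmetric]])
      (auto simp: Hom_iff Comp_reassoc[OF d(5)])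
  moreover have "out ?H \<cdot> d = out A \<cdot> MPart C ?\<alpha>"
    by (rule epi_cancel[OF EE_epi[OF EPart_EE[OF w(1)]]]) (use d w a ha h(4) in simp_all)
  ultimately show ?thesis
    using Comp_reassoc[of "out ?H" d "out A \<cdot> MPart C ?\<alpha>" r'] d w a ha r'_props r'(2)
    by (simp add: correct_up_to_def rec_language_def)
qed

text \<open>The left injection shows that \<alpha> factors through the copairing. If the copairing
  added nothing, the right injection would factor \<open>r\<close> through the image of \<alpha>,
  and the wrapper would already be correct up to \<rho>.\<close>

lemma counterexample_progress:
  assumes A: "automaton C A" and W: "closed C A W" "consistent C A W"
    and ce: "counterexample C A W S \<rho>"
    and r_def: "r = rec_ext C \<rho> (cotuple C (init A) (delta A))"
  shows "sub_le C (MPart C (fst W)) (MPart C (cotuple C (fst W) r))"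
    and "\<not> sub_le C (MPart C (cotuple C (fst W) r)) (MPart C (fst W))"
    and "cotuple C (fst W) r \<in> Arr C"
proof -
  let ?\<alpha> = "fst W" and ?c = "cotuple C (fst W) r"
  have \<rho>: "recursive C S \<rho>"
    using ce by (simp add: counterexample_def)
  have wr: "wrapper C (State A) W"
    using W by (simp add: closed_def)
  note w = wrapper_Arr_Dom_Cod[OF wr]
  have \<alpha>: "?\<alpha> \<in> Hom C (Dom C ?\<alpha>) (State A)"
    using w by (simp add: Hom_iff)
  have r: "r \<in> Hom C S (State A)"
    unfolding r_def using A rec_ext_props(1)[OF \<rho>] by (auto simp: automaton_def)
  note c = cotuple_props[OF \<alpha> r]
  have obj: "Dom C ?\<alpha> \<in> Obj C" "S \<in> Obj C"
    using w r by (auto simp: Hom_iff)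
  note In = In1_Hom[OF obj] In2_Hom[OF obj]
  show c_Arr: "?c \<in> Arr C"
    using c(1) by (simp add: Hom_iff)
  show "sub_le C (MPart C ?\<alpha>) (MPart C ?c)"
    using MPart_Comp_le[of ?c "In1 C (Dom C ?\<alpha>) S"] c(1,2) In by (simp add: Hom_iff)
  show "\<not> sub_le C (MPart C ?c) (MPart C ?\<alpha>)"
  proof
    assume "sub_le C (MPart C ?c) (MPart C ?\<alpha>)"
    then obtain f where f: "f \<in> Hom C (Dom C (MPart C ?c)) (Dom C (MPart C ?\<alpha>))"
      "MPart C ?c = MPart C ?\<alpha> \<cdot> f"
      by (auto simp: sub_le_def)
    define r' where "r' = f \<cdot> (EPart C ?c \<cdot> In2 C (Dom C ?\<alpha>) S)"
    have "r' \<in> Hom C S (Dom C (MPart C ?\<alpha>))"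
      unfolding r'_def using f(1) c(1) In by (simp add: Hom_iff)
    moreover have "r = MPart C ?\<alpha> \<cdot> r'"
      unfolding r'_def using f(1) c(1,3) In w
      by (simp add: Comp_reassoc[OF f(2)[symmetric]] Hom_iff)
    ultimately show False
      using correct_up_to_if_factors[OF A W \<rho>] ce by (auto simp: r_def counterexample_def)
  qed
qed

lemma run_step:
  assumes A: "automaton C A" and run: "run C A W" and n: "\<not> correct_hypothesis C A (W n)"
  shows "sub_le C (MPart C (fst (W n))) (MPart C (fst (W (Suc n))))"
    and "quot_le C (EPart C (snd (W (Suc n)))) (EPart C (snd (W n)))"
    and "\<not> (sub_le C (MPart C (fst (W (Suc n)))) (MPart C (fst (W n))) \<and>
      quot_le C (EPart C (snd (W n))) (EPart C (snd (W (Suc n)))))"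
proof -
  let ?a = "fst (W n)" and ?b = "snd (W n)" and ?a' = "fst (W (Suc n))" and ?b' = "snd (W (Suc n))"
  have wr: "wrapper C (State A) (W k)" for k
    using run by (simp add: run_def)
  note w = wrapper_Arr_Dom_Cod[OF wr[of n]] and w' = wrapper_Arr_Dom_Cod[OF wr[of "Suc n"]]
  have reflexive: "sub_le C (MPart C ?a) (MPart C ?a)" "quot_le C (EPart C ?b) (EPart C ?b)"
    using w by (simp_all add: sub_le_refl quot_le_refl)
  have "sub_le C (MPart C ?a) (MPart C ?a') \<and> quot_le C (EPart C ?b') (EPart C ?b) \<and>
    \<not> (sub_le C (MPart C ?a') (MPart C ?a) \<and> quot_le C (EPart C ?b) (EPart C ?b'))"
  proof -
    consider (not_closed) "\<not> closed C A (W n)"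
      | (not_consistent) "closed C A (W n)" "\<not> consistent C A (W n)"
      | (not_correct) "closed C A (W n)" "consistent C A (W n)" "\<not> correct_up_to_all C A (W n)"
      using n correct_hypothesis_iff[OF A] by blast
    then show ?thesis
    proof cases
      case not_closed
      then have "?b' = ?b" "locally_closed C A (?a', ?b) ?a"
        using run by (auto simp: run_def)
      moreover have "\<not> sub_le C (MPart C ?a') (MPart C ?a)"
        using locally_closed_imp_closed[OF A, of ?a ?b ?a'] wr[of n] not_closed calculation(2) by auto
      ultimately show ?thesis
        using reflexive by (auto simp: locally_closed_def)
    next
      case not_consistent
      then have "?a' = ?a" "locally_consistent C A (?a, ?b') ?b"
        using run by (auto simp: run_def)
      moreover have "\<not> quot_le C (EPart C ?b) (EPart C ?b')"
        using locally_consistent_imp_consistent[OF A, of ?a ?b ?b'] wr[of n] not_consistent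
          calculation(2) by auto
      ultimately show ?thesis
        using reflexive by (auto simp: locally_consistent_def)
    next
      case not_correct
      then obtain S \<rho> where ce: "counterexample C A (W n) S \<rho>"
        and iso: "sub_iso C (MPart C ?a')
          (MPart C (cotuple C ?a (rec_ext C \<rho> (cotuple C (init A) (delta A)))))"
        and b: "?b' = ?b"
        using run by (auto simp: run_def)
      define c where "c = cotuple C ?a (rec_ext C \<rho> (cotuple C (init A) (delta A)))"
      note p = counterexample_progress[OF A not_correct(1,2) ce refl, folded c_def]
      \<comment> \<open>The new subobject is prescribed only up to isomorphism, so the strict growth
        stated in \<open>p\<close> is carried over by comparison with \<open>c\<close>.\<close>
      have "sub_le C (MPart C ?a') (MPart C c)" "sub_le C (MPart C c) (MPart C ?a')"
        using iso sub_iso_imp_le sub_iso_imp_ge p(3) by (auto simp: c_def[symmetric])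
      then show ?thesis
        using p sub_le_trans w(1) w'(1) b reflexive MM_in_Arr MPart_MM by metis
    qed
  qed
  then show "sub_le C (MPart C ?a) (MPart C ?a')" "quot_le C (EPart C ?b') (EPart C ?b)"
    "\<not> (sub_le C (MPart C ?a') (MPart C ?a) \<and> quot_le C (EPart C ?b) (EPart C ?b'))"
    by auto
qed

text \<open>On a run that never becomes correct, the pairs of isomorphism classes of \<open>\<alpha>\<^sub>n\<^sup>\<triangleleft>\<close> and
  \<open>\<beta>\<^sub>n\<^sup>\<triangleright>\<close> are pairwise distinct.\<close>

lemma run_terminates:
  assumes A: "automaton C A" and run: "run C A W"
    and fin: "finitely_many_subobjects C (State A)" "finitely_many_quotients C (State A)"
  shows "\<exists>n. correct_hypothesis C A (W n)"
proof (rule ccontr)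
  assume "\<not> ?thesis"
  then have step: "\<not> correct_hypothesis C A (W n)" for n
    by simp
  note step = run_step[OF A run step]
  define a b where "a n = MPart C (fst (W n))" and "b n = EPart C (snd (W n))" for n
  let ?Q = "State A"
  have wr: "wrapper C ?Q (W k)" for k
    using run by (simp add: run_def)
  have a: "a n \<in> subobjects C ?Q" "a n \<in> Arr C" and b: "b n \<in> quotients C ?Q" "b n \<in> Arr C" for n
    using wrapper_Arr_Dom_Cod[OF wr[of n]]
    by (auto simp: a_def b_def subobjects_def quotients_def)
  have a_le: "sub_le C (a n) (a m)" if "n \<le> m" for n m
    using that
    by (induction rule: dec_induct)
      (auto simp: sub_le_refl a intro: sub_le_trans[OF _ step(1)[folded a_def]])
  have b_le: "quot_le C (b m) (b n)" if "n \<le> m" for n m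
    using that
    by (induction rule: dec_induct)
      (auto simp: quot_le_refl b intro: quot_le_trans[OF step(2)[folded b_def]])
  define R where "R = {(j, k) \<in> subobjects C ?Q \<times> subobjects C ?Q. sub_iso C j k}"
  define R' where "R' = {(x, y) \<in> quotients C ?Q \<times> quotients C ?Q. quot_iso C x y}"
  define cls where "cls n = (R `` {a n}, R' `` {b n})" for n
  have "cls n \<noteq> cls m" if "n < m" for n m
  proof
    assume eq: "cls n = cls m"
    \<comment> \<open>The two orders run in opposite directions along the run, so reflexivity is
      used at \<open>n\<close> for subobjects and at \<open>m\<close> for quotients.\<close>
    have "a n \<in> R `` {a n}" "b m \<in> R' `` {b m}"
      using a b by (auto simp: R_def R'_def sub_iso_refl quot_iso_refl)
    with eq have "(a m, a n) \<in> R" "(b n, b m) \<in> R'"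
      unfolding cls_def by blast+
    then have "sub_le C (a m) (a n)" "quot_le C (b n) (b m)"
      by (auto simp: R_def R'_def sub_iso_imp_le quot_iso_imp_le)
    \<comment> \<open>By monotonicity, equal classes at \<open>n\<close> and \<open>m\<close>
      collapse everything in between, in particular the single step after \<open>n\<close>, which is
      strict.\<close>
    then have "sub_le C (a (Suc n)) (a n)" "quot_le C (b n) (b (Suc n))"
      using a_le[of "Suc n" m] b_le[of "Suc n" m] that a b
      by (auto intro: sub_le_trans quot_le_trans)
    then show False
      using step(3)[of n] by (simp add: a_def b_def)
  qed
  then have "inj cls"
    by (metis injI linorder_neqE_nat)
  moreover have "range cls \<subseteq> (subobjects C ?Q // R) \<times> (quotients C ?Q // R')"
    using a b by (auto simp: cls_def intro: quotientI)
  moreover have "finite ((subobjects C ?Q // R) \<times> (quotients C ?Q // R'))"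
    using fin by (simp add: finitely_many_subobjects_def finitely_many_quotients_def R_def R'_def)
  ultimately show False
    using finite_subset finite_imageD infinite_UNIV_nat by blast
qed

lemma run_constant:
  assumes "automaton C A" and "run C A W" and "correct_hypothesis C A (W n)" and "n \<le> m"
  shows "W m = W n"
  using assms(4)
proof (induction rule: dec_induct)
  case (step k)
  then show ?case
    using assms(2,3) correct_hypothesis_iff[OF assms(1)] by (auto simp: run_def)
qed simp

section \<open>Minimality of the hypothesis\<close>

lemma sharp_automaton_hom:
  assumes "automaton C A" and "automaton C B" and "h \<in> automaton_hom C A B"
  shows "sharp C (delta B) (init B) = h \<cdot> sharp C (delta A) (init A)"
  using sharp_algebra_hom[of "init A" "InpObj C" "State A" "delta A" "delta B" "State B" h] assms
  by (auto simp: automaton_def automaton_hom_def)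

lemma automaton_hom_Comp:
  assumes "automaton C A" and "automaton C B" and "automaton C D"
    and "h \<in> automaton_hom C A B" and "k \<in> automaton_hom C B D"
  shows "k \<cdot> h \<in> automaton_hom C A D"
proof -
  note a = automaton_Arr_Dom_Cod[OF assms(1)] automaton_Arr_Dom_Cod[OF assms(2)]
    automaton_Arr_Dom_Cod[OF assms(3)]
  have h: "h \<in> Arr C" "Dom C h = State A" "Cod C h = State B"
    "delta B \<cdot> FArr C h = h \<cdot> delta A" "h \<cdot> init A = init B" "out B \<cdot> h = out A"
    and k: "k \<in> Arr C" "Dom C k = State B" "Cod C k = State D"
    "delta D \<cdot> FArr C k = k \<cdot> delta B" "k \<cdot> init B = init D" "out D \<cdot> k = out B"
    using assms(4,5) by (auto simp: automaton_hom_def Hom_iff)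
  show ?thesis
    using a h k Comp_reassoc[OF k(4), of "FArr C h"] Comp_reassoc[OF k(6), of h]
    by (simp add: automaton_hom_def Hom_iff FArr_Comp_Arr)
qed

lemma automaton_hom_inverse:
  assumes "automaton C A" and "automaton C B" and "k \<in> automaton_hom C A B"
    and "d \<in> Hom C (State B) (State A)" and "d \<cdot> k = Id C (State A)" and "k \<cdot> d = Id C (State B)"
  shows "d \<in> automaton_hom C B A"
proof -
  note a = automaton_Arr_Dom_Cod[OF assms(1)] automaton_Arr_Dom_Cod[OF assms(2)]
  have k: "k \<in> Arr C" "Dom C k = State A" "Cod C k = State B"
    "delta B \<cdot> FArr C k = k \<cdot> delta A" "k \<cdot> init A = init B" "out B \<cdot> k = out A"
    using assms(3) by (auto simp: automaton_hom_def Hom_iff)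
  have d: "d \<in> Arr C" "Dom C d = State B" "Cod C d = State A"
    using assms(4) by (auto simp: Hom_iff)
  have F: "FArr C k \<cdot> FArr C d = Id C (FObj C (State B))"
    using a d k assms(6) by (simp add: FArr_Comp_Arr[symmetric] FArr_Id)
  have "d \<cdot> delta B = d \<cdot> (delta B \<cdot> (FArr C k \<cdot> FArr C d))"
    using a d k F by simp
  also have "\<dots> = d \<cdot> (k \<cdot> (delta A \<cdot> FArr C d))"
    using a d k by (simp add: Comp_reassoc[OF k(4)])
  also have "\<dots> = delta A \<cdot> FArr C d"
    using a d k by (simp add: Comp_reassoc[OF assms(5)])
  finally have "delta A \<cdot> FArr C d = d \<cdot> delta B" ..
  moreover have "d \<cdot> init B = init A"
    using a d k Comp_reassoc[OF assms(5), of "init A"] by simp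
  moreover have "out A \<cdot> d = out B"
    using a d k Comp_reassoc[OF k(6), of d] assms(6) by simp
  ultimately show ?thesis
    using assms(4) by (simp add: automaton_hom_def)
qed

lemma minimal_hypothesis:
  assumes min: "minimal C A" and W: "correct_hypothesis C A W"
    and \<rho>: "recursive C S \<rho>" and \<alpha>: "fst W = rec_ext C \<rho> (cotuple C (init A) (delta A))"
  shows "minimal C (hypothesis C A W)"
proof -
  let ?H = "hypothesis C A W" and ?e = "e_wrap C W" and ?m = "m_wrap C W"
  \<comment> \<open>Both \<open>fst W\<close> and \<open>e_wrap C W\<close> will be factored through
    this extension into \<open>TI\<close>.\<close>
  define t where "t = rec_ext C \<rho> (cotuple C (eta C (InpObj C)) (gamma C (InpObj C)))"
  have A: "automaton C A" and A_reach: "sharp C (delta A) (init A) \<in> EE C"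
    using min by (auto simp: minimal_def reachable_def)
  have cc: "closed C A W" "consistent C A W" and lang: "language C ?H = language C A"
    using W by (auto simp: correct_hypothesis_def)
  note h = hypothesis_props[OF A cc]
  have wr: "wrapper C (State A) W"
    using cc by (simp add: closed_def)
  note w = wrapper_Arr_Dom_Cod[OF wr]
  have A_Hom: "init A \<in> Hom C (InpObj C) (State A)" "delta A \<in> Hom C (FObj C (State A)) (State A)"
    and H_Hom: "init ?H \<in> Hom C (InpObj C) (State ?H)"
      "delta ?H \<in> Hom C (FObj C (State ?H)) (State ?H)"
    using A h(1) by (auto simp: automaton_def)
  note sA = sharp_props(1)[OF A_Hom, unfolded Hom_iff]
    and sH = sharp_props(1)[OF H_Hom, unfolded Hom_iff h(2)]
  have t: "t \<in> Arr C" "Dom C t = S" "Cod C t = TObj C (InpObj C)"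
    using rec_ext_props(1)[OF \<rho> eta_Hom gamma_Hom] by (auto simp: t_def Hom_iff)
  have \<alpha>t: "fst W = sharp C (delta A) (init A) \<cdot> t"
    unfolding \<alpha> t_def by (rule rec_ext_eq_sharp_Comp[OF \<rho> A_Hom])
  have "fst W \<in> Hom C S (State A)"
    unfolding \<alpha> by (rule rec_ext_props(1)[OF \<rho> A_Hom])
  \<comment> \<open>With \<open>x\<close> the map \<open>?e\<close> and \<open>r\<close> the map
    \<alpha>, the two conditions to check are the factorisation of \<beta>\<alpha> and the
    transition equation of the hypothesis.\<close>
  then have "rec_ext C \<rho> (cotuple C (init ?H) (delta ?H)) = ?e"
    using w by (intro rec_ext_hypothesis_eqI[OF A cc \<rho> \<alpha> _ _ h(5)]) (auto simp: Hom_iff)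
  then have et: "?e = sharp C (delta ?H) (init ?H) \<cdot> t"
    using rec_ext_eq_sharp_Comp[OF \<rho> H_Hom] by (simp add: t_def)
  have "sharp C (delta ?H) (init ?H) \<cdot> t \<in> EE C"
    using w(5) unfolding et .
  then have "sharp C (delta ?H) (init ?H) \<in> EE C"
    by (rule EE_cancel_right) (use sH t in simp_all)
  then have H_reach: "reachable C ?H"
    using h(1) by (simp add: reachable_def)
  then obtain k where k: "k \<in> automaton_hom C ?H A"
    using min lang by (auto simp: minimal_def)
  have k_props: "k \<in> Arr C" "Dom C k = H_wrap C W" "Cod C k = State A"
    using k by (auto simp: automaton_hom_def Hom_iff h(2))
  note sk = sharp_automaton_hom[OF h(1) A k]
  \<comment> \<open>Reachability of the target: its map out of \<open>TI\<close> is \<open>k\<close>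
    after that of the hypothesis, and right cancellation applies.\<close>
  have k_EE: "k \<in> EE C"
    using EE_cancel_right[of k "sharp C (delta ?H) (init ?H)"] A_reach sk sH k_props by simp
  have ke: "k \<cdot> ?e = fst W"
    unfolding et \<alpha>t sk using sH k_props t by simp
  have "?m = snd W \<cdot> k"
    by (rule epi_cancel[OF EE_epi[OF w(5)]]) (use w k_props ke in simp_all)
  \<comment> \<open>The square from \<open>k\<close> to \<open>?m\<close> with an identity on top
    has a diagonal, a left inverse of \<open>k\<close>; as \<open>k\<close> is epi, it is
    two-sided.\<close>
  then obtain d where d: "d \<in> Arr C" "Dom C d = State A" "Cod C d = H_wrap C W"
      "d \<cdot> k = Id C (H_wrap C W)"
    using k_EE k_props w Cod_Obj[of ?e]
      diagonal_fill_in[of k ?m "Id C (H_wrap C W)" "snd W"] by auto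
  have "k \<cdot> d = Id C (State A)"
    by (rule epi_cancel[OF EE_epi[OF k_EE]]) (use d k_props A in \<open>auto simp: automaton_def\<close>)
  then have d_hom: "d \<in> automaton_hom C A ?H"
    using automaton_hom_inverse[OF h(1) A k] d h(2) by (simp add: Hom_iff)
  show ?thesis
    unfolding minimal_def
  proof (intro conjI allI impI H_reach)
    fix B
    assume "reachable C B \<and> language C B = language C ?H"
    moreover from this obtain g where "g \<in> automaton_hom C B A"
      using min lang by (auto simp: minimal_def)
    ultimately show "automaton_hom C B ?H \<noteq> {}"
      using automaton_hom_Comp[OF _ A h(1) _ d_hom] by (auto simp: reachable_def)
  qed
qed

end

theorem theorem25:
  fixes C :: "('o, 'm, 'x) learning_category_scheme"
    and A :: "('o, 'm) automaton"
    and W :: "nat \<Rightarrow> 'm \<times> 'm"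
  assumes "learning_category C"
    and "automaton C A"
    and "finitely_many_subobjects C (State A)"
    and "finitely_many_quotients C (State A)"
    and "run C A W"
  shows "(\<exists>n. correct_hypothesis C A (W n)) \<and>
    (minimal C A \<and>
       (\<forall>k. \<exists>S \<rho>. recursive C S \<rho> \<and> fst (W k) = rec_ext C \<rho> (cotuple C (init A) (delta A))) \<longrightarrow>
     (\<forall>n. correct_hypothesis C A (W n) \<longrightarrow>
        (\<forall>m \<ge> n. W m = W n) \<and> minimal C (hypothesis C A (W n))))"
proof -
  interpret learning_category C
    by (rule assms(1))
  show ?thesis
    using run_terminates[OF assms(2,5,3,4)] run_constant[OF assms(2,5)] minimal_hypothesis by metis
qed

end
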